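(* Let $n$ be a positive integer, $\tau>0$, and $a_0,\dots,a_{n-1},\alpha_0,\dots,\alpha_{n-1}\in\mathbb R$. Consider the quasipolynomial $\Delta:\mathbb C\to\mathbb C$, \[ \Delta(s)=s^n+\sum_{k=0}^{n-1}a_k s^k+e^{-s\tau}\sum_{k=0}^{n-1}\alpha_k s^k , \] and let $s_0\in\mathbb R$. (a) $s_0$ is a root of multiplicity $2n$ of $\Delta$ if and only if, for every $k\in\{0,\dots,n-1\}$, \[ a_k=\binom{n}{k}(-s_0)^{n-k}+(-1)^{n-k}\,n!\sum_{j=k}^{n-1}\binom{j}{k}\binom{2n-j-1}{n-1}\frac{s_0^{\,j-k}}{j!\,\tau^{n-j}}, \qquad \alpha_k=(-1)^{n-1}e^{s_0\tau}\sum_{j=k}^{n-1}\frac{(-1)^{j-k}(2n-j-1)!}{k!\,(j-k)!\,(n-j-1)!}\frac{s_0^{\,j-k}}{\tau^{n-j}}. \] (b) If the coefficients satisfy the conditions in (a), then $s_0$ is a strictly dominant root of $\Delta$, i.e., every root $s\neq s_0$ of $\Delta$ satisfies $\operatorname{Re} s<s_0$. (c) If the coefficients satisfy the conditions in (a), then the trivial solution of the delay-differential equation \[ y^{(n)}(t)+a_{n-1}y^{(n-1)}(t)+\dots+a_0y(t)+\alpha_{n-1}y^{(n-1)}(t-\tau)+\dots+\alpha_0y(t-\tau)=0 \] (with real-valued unknown $y$) is exponentially stable if and only if $a_{n-1}>-\frac{n^2}{\tau}$.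
   Context: Binomial coefficients $\binom{m}{k}$ are the usual ones. A root $s_0$ of $\Delta$ has multiplicity $2n$ when $\Delta^{(k)}(s_0)=0$ for $k=0,\dots,2n-1$ (multiplicity can be at most $2n$ for this quasipolynomial). The trivial solution of the delay-differential equation is exponentially stable if there exist $C,\gamma>0$ such that every solution satisfies $|y(t)|\le Ce^{-\gamma t}\max_{\theta\in[-\tau,0]}|y(\theta)|$ for $t\ge0$ (for retarded equations this is equivalent to all roots of $\Delta$ having real part bounded by a negative number, i.e., the spectral abscissa $\sup\{\operatorname{Re}s:\Delta(s)=0\}$ being negative).
   Formalization: In (c) stability is measured by the maximum over [-τ,0] of |y|,…,|y^(n-1)| instead of |y| alone (with |y| alone the bound fails for every n≥2), and solutions are required to be n times differentiable on all of [-τ,∞). *)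

theory Defs
  imports "HOL-Analysis.Analysis"
begin

definition Delta :: "nat \<Rightarrow> real \<Rightarrow> (nat \<Rightarrow> real) \<Rightarrow> (nat \<Rightarrow> real) \<Rightarrow> complex \<Rightarrow> complex" where
  "Delta n \<tau> a \<alpha> s =
     s ^ n + (\<Sum>k<n. complex_of_real (a k) * s ^ k)
     + exp (- s * complex_of_real \<tau>) * (\<Sum>k<n. complex_of_real (\<alpha> k) * s ^ k)"

definition root_mult_2n :: "nat \<Rightarrow> real \<Rightarrow> (nat \<Rightarrow> real) \<Rightarrow> (nat \<Rightarrow> real) \<Rightarrow> complex \<Rightarrow> bool" where
  "root_mult_2n n \<tau> a \<alpha> s0 \<longleftrightarrow> (\<forall>k < 2 * n. (deriv ^^ k) (Delta n \<tau> a \<alpha>) s0 = 0)"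

definition coeff_a :: "nat \<Rightarrow> real \<Rightarrow> real \<Rightarrow> nat \<Rightarrow> real" where
  "coeff_a n \<tau> s0 k =
     real (n choose k) * (- s0) ^ (n - k)
     + (-1) ^ (n - k) * fact n *
       (\<Sum>j = k..n - 1. real (j choose k) * real ((2 * n - j - 1) choose (n - 1))
                          * s0 ^ (j - k) / (fact j * \<tau> ^ (n - j)))"

definition coeff_alpha :: "nat \<Rightarrow> real \<Rightarrow> real \<Rightarrow> nat \<Rightarrow> real" where
  "coeff_alpha n \<tau> s0 k =
     (-1) ^ (n - 1) * exp (s0 * \<tau>) *
       (\<Sum>j = k..n - 1. (-1) ^ (j - k) * fact (2 * n - j - 1)
                          / (fact k * fact (j - k) * fact (n - j - 1))
                          * s0 ^ (j - k) / \<tau> ^ (n - j))"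

definition coeff_conditions :: "nat \<Rightarrow> real \<Rightarrow> (nat \<Rightarrow> real) \<Rightarrow> (nat \<Rightarrow> real) \<Rightarrow> real \<Rightarrow> bool" where
  "coeff_conditions n \<tau> a \<alpha> s0 \<longleftrightarrow>
     (\<forall>k < n. a k = coeff_a n \<tau> s0 k \<and> \<alpha> k = coeff_alpha n \<tau> s0 k)"

definition dde_solution :: "nat \<Rightarrow> real \<Rightarrow> (nat \<Rightarrow> real) \<Rightarrow> (nat \<Rightarrow> real) \<Rightarrow> (nat \<Rightarrow> real \<Rightarrow> real) \<Rightarrow> bool" where
  "dde_solution n \<tau> a \<alpha> Y \<longleftrightarrow>
     (\<forall>k < n. \<forall>t \<ge> - \<tau>. (Y k has_real_derivative Y (Suc k) t) (at t within {- \<tau>..}))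
     \<and> (\<forall>t \<ge> 0. Y n t + (\<Sum>k<n. a k * Y k t) + (\<Sum>k<n. \<alpha> k * Y k (t - \<tau>)) = 0)"

text \<open>Size of the initial data on [-tau, 0] (phase-space norm of (y, ..., y^(n-1))).\<close>
definition init_norm :: "nat \<Rightarrow> real \<Rightarrow> (nat \<Rightarrow> real \<Rightarrow> real) \<Rightarrow> real" where
  "init_norm n \<tau> Y = Sup {\<bar>Y k \<theta>\<bar> | k \<theta>. k < n \<and> \<theta> \<in> {- \<tau>..0}}"

definition exp_stable :: "nat \<Rightarrow> real \<Rightarrow> (nat \<Rightarrow> real) \<Rightarrow> (nat \<Rightarrow> real) \<Rightarrow> bool" where
  "exp_stable n \<tau> a \<alpha> \<longleftrightarrow>
     (\<exists>C \<gamma>. C > 0 \<and> \<gamma> > 0 \<and>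
        (\<forall>Y. dde_solution n \<tau> a \<alpha> Y \<longrightarrow>
             (\<forall>t \<ge> 0. \<bar>Y 0 t\<bar> \<le> C * exp (- \<gamma> * t) * init_norm n \<tau> Y)))"

end

theory Submission
  imports Defs "HOL-Complex_Analysis.Complex_Analysis"
    "HOL-Computational_Algebra.Fundamental_Theorem_Algebra"
begin

text \<open>
  Write \<open>z = \<tau> (s - s\<^sub>0)\<close>. Repeated integration by parts shows that \<^const>\<open>Delta\<close> with the stated
  coefficients is a constant multiple of \<open>z\<^sup>2\<^sup>n \<integral>\<^sub>0\<^sup>1 u\<^sup>n\<^sup>-\<^sup>1 (1 - u)\<^sup>n exp (- z u) du\<close>, a Kummer function times \<open>z\<^sup>2\<^sup>n\<close>;
  uniqueness of the coefficients holds because \<open>p + exp (- \<tau> s) q\<close> with \<open>p\<close>, \<open>q\<close> of degree below \<open>n\<close>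
  has no zero of order \<open>2 n\<close> unless \<open>p = q = 0\<close>.

  For dominance, the Kummer equation is restricted to the ray through a zero \<open>z\<close> of the integral and
  multiplied by the conjugate of the solution (the Green--Hille method); if \<open>Re z \<ge> 0\<close>, the imaginary
  part of the resulting flux is monotone and vanishes at both ends.

  For stability, a solution is cut into windows of length \<open>\<tau>\<close>. The generating function with coefficients
  \<open>y (\<theta> + j \<tau>)\<close> in the variable \<open>\<zeta>\<close> solves an ordinary differential equation with boundary conditions
  twisted by \<open>\<zeta>\<close>, which is uniformly well posed for \<open>\<bar>\<zeta>\<bar> \<le> r\<close> as long as no root \<open>s\<close> of \<^const>\<open>Delta\<close> has
  \<open>\<bar>exp (- s \<tau>)\<bar> \<le> r\<close>. Uniformity of the bound lets the radius of convergence be pushed up to some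
  \<open>r > 1\<close>, and Cauchy's inequality yields exponential decay.
\<close>

subsection \<open>A Kummer-type integral and its zeros\<close>

text \<open>For m = 0 this is exp (w / 2) times Kummer's function M(n, 2n+1, -w), up to the constant
  Beta(n, n+1). Centring the exponent at u = 1/2 removes the term w F' from Kummer's equation; each
  unit of \<open>m\<close> is one derivative in \<open>w\<close>.\<close>

definition beta_transform :: "nat \<Rightarrow> nat \<Rightarrow> complex \<Rightarrow> complex" where
  "beta_transform n m w = integral {0..1}
     (\<lambda>u. complex_of_real (u ^ (n - 1) * (1 - u) ^ n * (1 / 2 - u) ^ m) * exp (w * of_real (1 / 2 - u)))"

lemma beta_transform_has_integral:
  "((\<lambda>u. complex_of_real (u ^ (n - 1) * (1 - u) ^ n * (1 / 2 - u) ^ m) * exp (w * of_real (1 / 2 - u)))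
     has_integral beta_transform n m w) {0..1}"
  unfolding beta_transform_def
  by (intro integrable_integral integrable_continuous_interval continuous_intros)

lemma beta_transform_has_field_derivative:
  "(beta_transform n m has_field_derivative beta_transform n (Suc m) w) (at w)"
proof -
  let ?f = "\<lambda>m w u. complex_of_real (u ^ (n - 1) * (1 - u) ^ n * (1 / 2 - u) ^ m) * exp (w * of_real (1 / 2 - u))"
  have "((\<lambda>w. integral (cbox 0 1) (?f m w)) has_field_derivative
          integral (cbox 0 1) (?f (Suc m) w)) (at w within UNIV)"
  proof (rule leibniz_rule_field_derivative)
    show "((\<lambda>w. ?f m w u) has_field_derivative ?f (Suc m) w u) (at w within UNIV)" for w u
      by (auto intro!: derivative_eq_intros simp: algebra_simps)
    show "?f m w integrable_on cbox 0 1" for w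
      using beta_transform_has_integral[of n m w] by (auto simp: cbox_interval)
    show "continuous_on (UNIV \<times> cbox 0 1) (\<lambda>(w, u). ?f (Suc m) w u)"
      unfolding case_prod_unfold by (intro continuous_intros)
  qed auto
  then show ?thesis
    by (simp add: beta_transform_def[abs_def] cbox_interval)
qed

text \<open>The difference of the two sides is the integral of the derivative of \<open>?F\<close>,
  and \<open>?F\<close> vanishes at both ends of the interval.\<close>

lemma beta_transform_ode:
  assumes "n > 0"
  shows "w * beta_transform n 2 w + of_nat (2 * n + 1) * beta_transform n 1 w
           = (w / 4 + 1 / 2) * beta_transform n 0 w"
proof -
  let ?f = "\<lambda>m u. complex_of_real (u ^ (n - 1) * (1 - u) ^ n * (1 / 2 - u) ^ m) * exp (w * of_real (1 / 2 - u))"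
  let ?F = "\<lambda>u. complex_of_real (u ^ n * (1 - u) ^ (n + 1)) * exp (w * of_real (1 / 2 - u))"
  obtain n' where n: "n = Suc n'" using assms gr0_implies_Suc by blast
  have 1: "((\<lambda>u. w * ?f 2 u + of_nat (2 * n + 1) * ?f 1 u - (w / 4 + 1 / 2) * ?f 0 u)
          has_integral (w * beta_transform n 2 w + of_nat (2 * n + 1) * beta_transform n 1 w
            - (w / 4 + 1 / 2) * beta_transform n 0 w)) {0..1}"
    by (intro has_integral_add has_integral_diff has_integral_mult_right beta_transform_has_integral)
  have 2: "((\<lambda>u. w * ?f 2 u + of_nat (2 * n + 1) * ?f 1 u - (w / 4 + 1 / 2) * ?f 0 u)
          has_integral (?F 1 - ?F 0)) {0..1}"
  proof (rule fundamental_theorem_of_calculus)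
    fix u :: real
    have 1: "((\<lambda>u::complex. u ^ n * (1 - u) ^ (n + 1) * exp (w * (1 / 2 - u))) has_field_derivative
       (of_nat n * U ^ (n - 1) * (1 - U) ^ (n + 1) - of_nat (n + 1) * U ^ n * (1 - U) ^ n
         - w * U ^ n * (1 - U) ^ (n + 1)) * exp (w * (1 / 2 - U))) (at U)" for U
    proof -
      have "((\<lambda>u::complex. u ^ n) has_field_derivative of_nat n * U ^ (n - 1)) (at U)"
        by (auto intro!: derivative_eq_intros)
      moreover have "((\<lambda>u::complex. (1 - u) ^ (n + 1)) has_field_derivative - (of_nat (n + 1) * (1 - U) ^ n)) (at U)"
        by (auto intro!: derivative_eq_intros simp del: power_Suc)
      moreover have "((\<lambda>u::complex. exp (w * (1 / 2 - u))) has_field_derivative - w * exp (w * (1 / 2 - U))) (at U)"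
        by (auto intro!: derivative_eq_intros)
      ultimately show ?thesis
        by (rule DERIV_mult[OF DERIV_mult, THEN DERIV_cong]) (simp add: algebra_simps)
    qed
    \<comment> \<open>The bracket is n (1 - U) - (n + 1) U - w U (1 - U), rewritten in powers of 1/2
      - U because these powers index the derivatives in \<open>w\<close>.\<close>
    have 2: "of_nat n * U ^ (n - 1) * (1 - U) ^ (n + 1) - of_nat (n + 1) * U ^ n * (1 - U) ^ n
         - w * U ^ n * (1 - U) ^ (n + 1)
       = U ^ (n - 1) * (1 - U) ^ n * (w * (1 / 2 - U)^2 + of_nat (2 * n + 1) * (1 / 2 - U) - (w / 4 + 1 / 2))" for U :: complex
      unfolding n by (simp add: field_simps power2_eq_square)
    have "((\<lambda>u. of_real u ^ n * (1 - of_real u) ^ (n + 1) * exp (w * (1 / 2 - of_real u)))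
        has_vector_derivative (of_real u ^ (n - 1) * (1 - of_real u) ^ n *
          (w * (1 / 2 - of_real u)^2 + of_nat (2 * n + 1) * (1 / 2 - of_real u) - (w / 4 + 1 / 2)))
           * exp (w * (1 / 2 - of_real u))) (at u within {0..1})"
      using 1[of "of_real u", unfolded 2]
      by (rule has_vector_derivative_real_field)
    moreover have "?F = (\<lambda>u. of_real u ^ n * (1 - of_real u) ^ (n + 1) * exp (w * (1 / 2 - of_real u)))"
      by simp
    moreover have "w * ?f 2 u + of_nat (2 * n + 1) * ?f 1 u - (w / 4 + 1 / 2) * ?f 0 u =
        of_real u ^ (n - 1) * (1 - of_real u) ^ n *
          (w * (1 / 2 - of_real u)^2 + of_nat (2 * n + 1) * (1 / 2 - of_real u) - (w / 4 + 1 / 2))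
           * exp (w * (1 / 2 - of_real u))"
      by (simp add: algebra_simps)
    ultimately show "(?F has_vector_derivative
      (w * ?f 2 u + of_nat (2 * n + 1) * ?f 1 u - (w / 4 + 1 / 2) * ?f 0 u)) (at u within {0..1})"
      by (simp only:)
  qed auto
  have "?F 1 - ?F 0 = 0"
    using assms by simp
  then have "w * beta_transform n 2 w + of_nat (2 * n + 1) * beta_transform n 1 w
            - (w / 4 + 1 / 2) * beta_transform n 0 w = 0"
    using has_integral_unique[OF 1 2] by simp
  then show ?thesis by simp
qed

text \<open>For real argument the integrand is nonnegative, and positive at u = 1/2. This rules out
  real zeros, and later a zero at the start of the ray.\<close>

lemma beta_transform_real_pos:
  assumes "n > 0"
  shows "\<exists>r > 0. beta_transform n 0 (complex_of_real x) = complex_of_real r"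
proof -
  let ?f = "\<lambda>u. u ^ (n - 1) * (1 - u) ^ n * exp (x * (1 / 2 - u))"
  have c: "continuous_on {0..1} ?f" by (intro continuous_intros)
  then have i: "(?f has_integral integral {0..1} ?f) {0..1}"
    by (intro integrable_integral integrable_continuous_interval)
  have ge: "integral {0..1} ?f \<ge> 0"
    by (intro integral_nonneg has_integral_integrable[OF i]) auto
  have "integral {0..1} ?f \<noteq> 0"
  proof
    assume "integral {0..1} ?f = 0"
    with i have "(?f has_integral 0) (cbox 0 1)" by (simp add: cbox_interval)
    then have "?f (1/2) = 0"
      by (rule has_integral_0_cbox_imp_0[rotated 2]) (use c in \<open>auto simp: cbox_interval\<close>)
    then show False by simp
  qed
  moreover have "beta_transform n 0 (complex_of_real x) = of_real (integral {0..1} ?f)"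
  proof -
    have "((\<lambda>u. complex_of_real (?f u)) has_integral of_real (integral {0..1} ?f)) {0..1}"
      using i by (rule has_integral_of_real)
    also have "(\<lambda>u. complex_of_real (?f u)) = (\<lambda>u. complex_of_real (u ^ (n - 1) * (1 - u) ^ n * (1 / 2 - u) ^ 0) * exp (of_real x * of_real (1 / 2 - u)))"
      by (intro ext) (simp only: of_real_mult[symmetric] exp_of_real power_0 mult_1_right)
    finally show ?thesis
      by (rule has_integral_unique[OF beta_transform_has_integral])
  qed
  ultimately show ?thesis using ge by (intro exI[of _ "integral {0..1} ?f"]) auto
qed

text \<open>Suppose Re z >= 0. Along the segment from 0 to \<open>z\<close> the flux
  \<open>h\<close> vanishes at t = 0 because of its power of t, and at t = 1 because of the zero.
  Its derivative \<open>h'\<close> has the sign of Im z throughout, so \<open>h\<close> is constant,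
  \<open>g\<close> vanishes on (0, 1), and g(0) = 0 contradicts positivity.\<close>

lemma beta_transform_zero_Re_neg:
  assumes n: "n > 0" and zero: "beta_transform n 0 z = 0"
  shows "Re z < 0"
proof (rule ccontr)
  assume "\<not> Re z < 0"
  then have x: "Re z \<ge> 0" by simp
  define x y where "x = Re z" and "y = Im z"
  have y: "y \<noteq> 0"
  proof
    assume "y = 0"
    then have "z = of_real (Re z)" by (simp add: complex_eq_iff y_def)
    then show False using beta_transform_real_pos[OF n, of "Re z"] zero by auto
  qed
  define g where "g t = beta_transform n 0 (of_real t * z)" for t :: real
  define g1 where "g1 t = z * beta_transform n 1 (of_real t * z)" for t :: real
  define g2 where "g2 t = z ^ 2 * beta_transform n 2 (of_real t * z)" for t :: real
  have d: "((\<lambda>t. beta_transform n m (of_real t * z)) has_vector_derivative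
             z * beta_transform n (Suc m) (of_real t * z)) (at t within S)" for m t S
  proof -
    have "((\<lambda>w. beta_transform n m (w * z)) has_field_derivative
             beta_transform n (Suc m) (of_real t * z) * z) (at (of_real t))"
      by (rule DERIV_chain2[of "beta_transform n m", OF beta_transform_has_field_derivative])
         (auto intro!: derivative_eq_intros)
    then show ?thesis
      using has_vector_derivative_real_field[of "\<lambda>w. beta_transform n m (w * z)"] by (simp add: mult.commute)
  qed
  have dg: "(g has_vector_derivative g1 t) (at t)" for t
    using d[of 0 t UNIV] by (simp add: g_def[abs_def] g1_def)
  have dg1: "(g1 has_vector_derivative g2 t) (at t)" for t
    using has_vector_derivative_mult_right[OF d[of 1 t UNIV], of z]
    by (simp add: g1_def[abs_def] g2_def numeral_2_eq_2 mult.assoc)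
  have ode: "of_real t * g2 t + of_nat (2 * n + 1) * g1 t = (of_real t * z ^ 2 / 4 + z / 2) * g t" for t
  proof -
    have "of_real t * g2 t + of_nat (2 * n + 1) * g1 t = z * (of_real t * z * beta_transform n 2 (of_real t * z)
         + of_nat (2 * n + 1) * beta_transform n 1 (of_real t * z))"
      by (simp add: g2_def g1_def algebra_simps power2_eq_square)
    also have "\<dots> = (of_real t * z ^ 2 / 4 + z / 2) * g t"
      unfolding beta_transform_ode[OF n] g_def by (simp add: algebra_simps power2_eq_square)
    finally show ?thesis .
  qed
  \<comment> \<open>\<open>t ^ (2 * n + 1)\<close> is the integrating factor of t g'' + (2n+1) g'.
    The term |g'|^2 that arises from differentiating the product is real and drops out of the
    imaginary part.\<close>
  define h where "h t = t ^ (2 * n + 1) * Im (g1 t * cnj (g t))" for t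
  define h' where "h' t = t ^ (2 * n) * (t * x + 1) * (y / 2) * (cmod (g t))\<^sup>2" for t
  have dh: "(h has_real_derivative h' t) (at t)" for t
  proof -
    have "((\<lambda>t. g1 t * cnj (g t)) has_vector_derivative g1 t * cnj (g1 t) + g2 t * cnj (g t)) (at t)"
      by (intro has_vector_derivative_mult dg1 dg has_vector_derivative_cnj)
    then have "((\<lambda>t. Im (g1 t * cnj (g t))) has_vector_derivative Im (g1 t * cnj (g1 t) + g2 t * cnj (g t))) (at t)"
      by (rule bounded_linear.has_vector_derivative[OF bounded_linear_Im])
    then have "((\<lambda>t. Im (g1 t * cnj (g t))) has_real_derivative Im (g2 t * cnj (g t))) (at t)"
      by (simp add: has_real_derivative_iff_has_vector_derivative)
    then have "(h has_real_derivative real (2 * n + 1) * t ^ (2 * n) * Im (g1 t * cnj (g t))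
          + Im (g2 t * cnj (g t)) * t ^ (2 * n + 1)) (at t)"
      unfolding h_def[abs_def]
    proof (rule DERIV_mult[rotated, THEN DERIV_cong])
      show "((\<lambda>t. t ^ (2 * n + 1)) has_real_derivative real (2 * n + 1) * t ^ (2 * n)) (at t)"
        by (auto intro!: derivative_eq_intros simp del: power_Suc)
    qed simp
    also have "real (2 * n + 1) * t ^ (2 * n) * Im (g1 t * cnj (g t)) + Im (g2 t * cnj (g t)) * t ^ (2 * n + 1)
        = t ^ (2 * n) * Im ((of_real t * g2 t + of_nat (2 * n + 1) * g1 t) * cnj (g t))"
    proof -
      have "(of_real t * g2 t + of_nat (2 * n + 1) * g1 t) * cnj (g t) =
         of_real t * (g2 t * cnj (g t)) + of_real (real (2 * n + 1)) * (g1 t * cnj (g t))"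
        by (simp add: algebra_simps)
      then have "Im ((of_real t * g2 t + of_nat (2 * n + 1) * g1 t) * cnj (g t)) =
          t * Im (g2 t * cnj (g t)) + real (2 * n + 1) * Im (g1 t * cnj (g t))"
        by (simp only: plus_complex.sel Im_complex_of_real Re_complex_of_real times_complex.sel)
      then show ?thesis by (simp only:) (simp add: algebra_simps)
    qed
    also have "\<dots> = h' t"
    proof -
      have "(of_real t * z ^ 2 / 4 + z / 2) * g t * cnj (g t) = (of_real t * z ^ 2 / 4 + z / 2) * of_real ((cmod (g t))\<^sup>2)"
        by (simp add: mult.assoc complex_mult_cnj cmod_power2)
      then have "Im ((of_real t * z ^ 2 / 4 + z / 2) * g t * cnj (g t))
           = Im (of_real t * z ^ 2 / 4 + z / 2) * (cmod (g t))\<^sup>2"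
        by (simp only: Im_complex_of_real Re_complex_of_real times_complex.sel)
      also have "Im (of_real t * z ^ 2 / 4 + z / 2) = (t * x + 1) * (y / 2)"
        by (simp add: x_def y_def power2_eq_square field_simps)
      finally show ?thesis unfolding ode h'_def by simp
    qed
    finally show ?thesis .
  qed
  have h01: "h 0 = 0" "h 1 = 0"
    using zero by (simp_all add: h_def g_def)
  have gz: "g t = 0" if t: "0 < t" "t < 1" for t
  proof -
    \<comment> \<open>The factor \<open>sgn y\<close> treats the upper and lower half-planes
      together.\<close>
    have mono: "sgn y * h s \<le> sgn y * h r" if "0 \<le> s" "s \<le> r" for s r
    proof (rule DERIV_nonneg_imp_nondecreasing[OF \<open>s \<le> r\<close>])
      fix q assume "s \<le> q" "q \<le> r"
      then have "q \<ge> 0" using that by simp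
      moreover have "((\<lambda>r. sgn y * h r) has_real_derivative sgn y * h' q) (at q)"
        by (intro DERIV_cmult dh)
      moreover have "sgn y * h' q = q ^ (2 * n) * (q * x + 1) * (\<bar>y\<bar> / 2) * (cmod (g q))\<^sup>2"
        by (simp add: h'_def abs_sgn)
      moreover have "x \<ge> 0" using x x_def by simp
      ultimately show "\<exists>l. ((\<lambda>r. sgn y * h r) has_real_derivative l) (at q) \<and> 0 \<le> l"
        by (intro exI[of _ "sgn y * h' q"]) (simp only:, simp)
    qed
    have hz: "h s = 0" if "s \<in> {0<..<1}" for s
      using mono[of 0 s] mono[of s 1] that y h01 by (auto simp: sgn_if split: if_splits)
    have "((\<lambda>s. 0::real) has_real_derivative h' t) (at t)"
      by (rule has_field_derivative_transform_within_open[OF dh, of "{0<..<1}"]) (use t hz in auto)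
    then have "h' t = 0"
      using DERIV_unique[OF DERIV_const[of 0]] by metis
    moreover have "t * x + 1 > 0" using t x x_def by (intro add_nonneg_pos mult_nonneg_nonneg) auto
    ultimately show ?thesis using t y by (auto simp: h'_def)
  qed
  \<comment> \<open>The weight \<open>t ^ (2 * n)\<close> in \<open>h'\<close> degenerates at 0, so
    g(0) = 0 is obtained as a limit from the right.\<close>
  have "isCont g 0"
    by (rule has_vector_derivative_continuous[OF dg])
  then have "(g \<longlongrightarrow> g 0) (at_right 0)"
    unfolding isCont_def by (rule tendsto_within_subset) simp
  moreover have "eventually (\<lambda>t. g t = 0) (at_right 0)"
    by (rule eventually_at_rightI[of 0 1]) (use gz in auto)
  ultimately have "g 0 = 0"
    using tendsto_unique[OF _ _ tendsto_eventually] trivial_limit_at_right_real by blast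
  then show False
    using beta_transform_real_pos[OF n, of 0] by (auto simp: g_def)
qed

subsection \<open>Multiplicity of the root and the coefficients\<close>

text \<open>Repeated integration by parts in one stroke: \<open>- exp (- z * u) * T u\<close> is an
  antiderivative, since z T - T' telescopes to z^(d+1) p once the derivatives beyond the degree
  vanish. Multiplying through by z^(d+1) avoids any division by \<open>z\<close>.\<close>

lemma exp_poly_has_integral:
  fixes p :: "complex poly" and z :: complex
  assumes deg: "degree p \<le> d"
  defines "T \<equiv> \<lambda>x. \<Sum>k\<le>d. z ^ (d - k) * poly ((pderiv ^^ k) p) x"
  shows "((\<lambda>u. z ^ Suc d * poly p (of_real u) * exp (- z * of_real u)) has_integral T 0 - exp (- z) * T 1) {0..1}"
proof -
  let ?F = "\<lambda>u. - exp (- z * u) * T u"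
  have tele: "z * T x - (\<Sum>k\<le>d. z ^ (d - k) * poly ((pderiv ^^ Suc k) p) x) = z ^ Suc d * poly p x" for x
  proof -
    let ?f = "\<lambda>k. z ^ (Suc d - k) * poly ((pderiv ^^ k) p) x"
    have "(pderiv ^^ Suc d) p = 0"
    proof (rule poly_eqI)
      show "coeff ((pderiv ^^ Suc d) p) i = coeff 0 i" for i
        using deg by (subst coeff_higher_pderiv) (auto simp: coeff_eq_0)
    qed
    moreover have "(\<Sum>k\<le>d. ?f k - ?f (Suc k)) = ?f 0 - ?f (Suc d)"
      by (rule sum_telescope)
    moreover have "z * T x - (\<Sum>k\<le>d. z ^ (d - k) * poly ((pderiv ^^ Suc k) p) x) = (\<Sum>k\<le>d. ?f k - ?f (Suc k))"
      unfolding T_def sum_distrib_left sum_subtractf[symmetric]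
      by (intro sum.cong) (auto simp: Suc_diff_le)
    ultimately show ?thesis by simp
  qed
  have dT: "(T has_field_derivative (\<Sum>k\<le>d. z ^ (d - k) * poly ((pderiv ^^ Suc k) p) x)) (at x)" for x
    unfolding T_def by (auto intro!: derivative_eq_intros simp: mult.commute)
  have "((\<lambda>u. z ^ Suc d * poly p (of_real u) * exp (- z * of_real u)) has_integral ?F (of_real 1) - ?F (of_real 0)) {0..1}"
  proof (rule fundamental_theorem_of_calculus)
    fix u :: real
    have "(?F has_field_derivative exp (- z * x) * (z * T x - (\<Sum>k\<le>d. z ^ (d - k) * poly ((pderiv ^^ Suc k) p) x))) (at x)" for x
      by (rule derivative_eq_intros dT refl)+ (simp add: algebra_simps)
    then have "(?F has_field_derivative z ^ Suc d * poly p x * exp (- z * x)) (at x)" for x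
      unfolding tele by (simp add: mult_ac)
    then show "((\<lambda>u. ?F (of_real u)) has_vector_derivative z ^ Suc d * poly p (of_real u) * exp (- z * of_real u))
        (at u within {0..1})"
      by (rule has_vector_derivative_real_field)
  qed auto
  then show ?thesis by simp
qed

text \<open>Lets the derivatives at an end point be read off from the expansion of the polynomial
  around that point.\<close>

lemma poly_higher_pderiv_conv_coeff:
  fixes p :: "complex poly"
  shows "poly ((pderiv ^^ k) p) c = fact k * coeff (p \<circ>\<^sub>p [:c, 1:]) k"
proof -
  have "(pderiv ^^ k) (p \<circ>\<^sub>p [:c, 1:]) = (pderiv ^^ k) p \<circ>\<^sub>p [:c, 1:]"
    by (induction k) (simp_all add: pderiv_pcompose pderiv_pCons)
  then have "coeff ((pderiv ^^ k) (p \<circ>\<^sub>p [:c, 1:])) 0 = poly ((pderiv ^^ k) p) c"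
    by (simp add: poly_0_coeff_0[symmetric] poly_pcompose)
  then show ?thesis
    by (simp add: coeff_higher_pderiv pochhammer_fact)
qed

text \<open>Integration by parts for p = u^(n-1) (1-u)^n; the factor \<open>exp (- z / 2)\<close>
  undoes the centring. The orders of vanishing of \<open>p\<close> at 0 and 1 determine which powers
  of \<open>z\<close> survive.\<close>

lemma beta_transform_explicit:
  assumes n: "n > 0"
  shows "z ^ (2 * n) * exp (- z / 2) * beta_transform n 0 z =
     fact (n - 1) * z ^ n + (\<Sum>j<n. (-1) ^ (n - j) * fact (2 * n - j - 1) * of_nat (n choose j) * z ^ j)
      - exp (- z) * (\<Sum>j<n. (-1) ^ n * fact (2 * n - j - 1) * of_nat ((n - 1) choose j) * z ^ j)"
proof -
  define d where "d = 2 * n - 1"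
  have Sd: "Suc d = 2 * n" using n by (simp add: d_def)
  define p :: "complex poly" where "p = monom 1 (n - 1) * [:1, -1:] ^ n"
  have poly_p: "poly p x = x ^ (n - 1) * (1 - x) ^ n" for x
    by (simp add: p_def poly_monom)
  have "degree ([:1, -1::complex:] ^ n) = n"
    by (subst degree_power_eq) auto
  then have deg: "degree p \<le> d"
    unfolding p_def d_def using n by (intro order.trans[OF degree_mult_le]) (simp add: degree_monom_eq)
  have I: "((\<lambda>u. z ^ (2 * n) * exp (- z / 2) * (complex_of_real (u ^ (n - 1) * (1 - u) ^ n * (1 / 2 - u) ^ 0) * exp (z * of_real (1 / 2 - u))))
     has_integral z ^ (2 * n) * exp (- z / 2) * beta_transform n 0 z) {0..1}"
    by (intro has_integral_mult_right beta_transform_has_integral)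
  have "z ^ (2 * n) * exp (- z / 2) * (complex_of_real (u ^ (n - 1) * (1 - u) ^ n * (1 / 2 - u) ^ 0) * exp (z * of_real (1 / 2 - u)))
      = z ^ Suc d * poly p (of_real u) * exp (- z * of_real u)" for u
  proof -
    have "exp (- z / 2) * exp (z * of_real (1 / 2 - u)) = exp (- z * of_real u)"
      by (simp add: algebra_simps flip: exp_add)
    then show ?thesis unfolding Sd poly_p by (simp add: mult_ac)
  qed
  note J = I[unfolded this]
  have 1: "z ^ (2 * n) * exp (- z / 2) * beta_transform n 0 z =
     (\<Sum>k\<le>d. z ^ (d - k) * poly ((pderiv ^^ k) p) 0) - exp (- z) * (\<Sum>k\<le>d. z ^ (d - k) * poly ((pderiv ^^ k) p) 1)"
    by (rule has_integral_unique[OF J exp_poly_has_integral[OF deg]])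
  have rev: "(\<Sum>k\<le>d. z ^ (d - k) * f k) = (\<Sum>j\<le>d. z ^ j * f (d - j))" for f
    by (rule sum.reindex_bij_witness[of _ "\<lambda>j. d - j" "\<lambda>j. d - j"]) auto
  \<comment> \<open>At 0 the polynomial vanishes to order n - 1, so only derivatives of order at
    least n - 1 count, that is j <= n; j = n is the leading power.\<close>
  have "(\<Sum>k\<le>d. z ^ (d - k) * poly ((pderiv ^^ k) p) 0) = (\<Sum>j\<le>n. (-1) ^ (n - j) * fact (2 * n - j - 1) * of_nat (n choose j) * z ^ j)"
    unfolding rev
  proof (rule sum.mono_neutral_cong_right)
    have p0: "poly ((pderiv ^^ k) p) 0 = fact k * coeff p k" for k
      unfolding poly_higher_pderiv_conv_coeff by (simp add: pcompose_idR)
    show "\<forall>j\<in>{..d} - {..n}. z ^ j * poly ((pderiv ^^ (d - j)) p) 0 = 0"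
      unfolding p0 using n by (auto simp: p_def coeff_monom_mult d_def)
    show "z ^ j * poly ((pderiv ^^ (d - j)) p) 0 = (-1) ^ (n - j) * fact (2 * n - j - 1) * of_nat (n choose j) * z ^ j"
      if "j \<in> {..n}" for j
    proof -
      have "d - j = 2 * n - j - 1" "\<not> d - j < n - 1" "d - j - (n - 1) = n - j"
        using that n by (auto simp: d_def)
      then have "coeff p (d - j) = (-1) ^ (n - j) * of_nat (n choose j)"
        using that by (simp add: p_def coeff_monom_mult coeff_linear_poly_power binomial_symmetric[symmetric])
      then show ?thesis unfolding p0 using \<open>d - j = 2 * n - j - 1\<close> by simp
    qed
  qed (use n in \<open>auto simp: d_def\<close>)
  also have "\<dots> = fact (n - 1) * z ^ n + (\<Sum>j<n. (-1) ^ (n - j) * fact (2 * n - j - 1) * of_nat (n choose j) * z ^ j)"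
    using n by (simp add: lessThan_Suc_atMost[symmetric] mult_2)
  finally have 2: "(\<Sum>k\<le>d. z ^ (d - k) * poly ((pderiv ^^ k) p) 0) = \<dots>" .
  have "(\<Sum>k\<le>d. z ^ (d - k) * poly ((pderiv ^^ k) p) 1) = (\<Sum>j<n. (-1) ^ n * fact (2 * n - j - 1) * of_nat ((n - 1) choose j) * z ^ j)"
    unfolding rev
  proof (rule sum.mono_neutral_cong_right)
    \<comment> \<open>At 1 the order of vanishing is n, one more than at 0, so the factor of exp
      (-z) has degree below n.\<close>
    have "p \<circ>\<^sub>p [:1, 1:] = monom ((-1) ^ n) n * [:1, 1:] ^ (n - 1)"
      unfolding poly_eq_poly_eq_iff[symmetric]
    proof
      fix x :: complex
      have "poly (p \<circ>\<^sub>p [:1, 1:]) x = (1 + x) ^ (n - 1) * (- x) ^ n"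
        by (simp add: poly_pcompose poly_p)
      also have "\<dots> = poly (monom ((-1) ^ n) n * [:1, 1:] ^ (n - 1)) x"
        unfolding power_minus[of x n] by (simp add: poly_monom mult_ac)
      finally show "poly (p \<circ>\<^sub>p [:1, 1:]) x = poly (monom ((-1) ^ n) n * [:1, 1:] ^ (n - 1)) x" .
    qed
    then have p1: "poly ((pderiv ^^ k) p) 1 = fact k * coeff (monom ((-1) ^ n) n * [:1, 1:] ^ (n - 1)) k" for k
      unfolding poly_higher_pderiv_conv_coeff by simp
    show "\<forall>j\<in>{..d} - {..<n}. z ^ j * poly ((pderiv ^^ (d - j)) p) 1 = 0"
      unfolding p1 using n by (auto simp: coeff_monom_mult d_def)
    show "z ^ j * poly ((pderiv ^^ (d - j)) p) 1 = (-1) ^ n * fact (2 * n - j - 1) * of_nat ((n - 1) choose j) * z ^ j"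
      if "j \<in> {..<n}" for j
    proof -
      have "d - j = 2 * n - j - 1" "\<not> d - j < n" "d - j - n = n - 1 - j" "j \<le> n - 1"
        using that n by (auto simp: d_def)
      moreover from this have "coeff ([:1, 1::complex:] ^ (n - 1)) (n - 1 - j) = of_nat ((n - 1) choose j)"
        using binomial_symmetric[of j "n - 1"] by (subst coeff_linear_poly_power) auto
      ultimately show ?thesis
        unfolding p1 coeff_monom_mult by simp
    qed
  qed (use n in \<open>auto simp: d_def\<close>)
  with 1 2 show ?thesis by simp
qed

text \<open>Binomial theorem after exchanging the two sums. The inner sums over j in the stated
  coefficients have this shape, so they re-expand around 0 a polynomial given in powers of s -
  s0.\<close>

lemma sum_taylor_shift:
  fixes b :: "nat \<Rightarrow> 'a :: comm_ring_1"
  shows "(\<Sum>k<n. (\<Sum>j = k..n - 1. b j * of_nat (j choose k) * (- s0) ^ (j - k)) * s ^ k) = (\<Sum>j<n. b j * (s - s0) ^ j)"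
proof -
  have "(\<Sum>k<n. (\<Sum>j = k..n - 1. b j * of_nat (j choose k) * (- s0) ^ (j - k)) * s ^ k)
      = (\<Sum>k<n. \<Sum>j | j \<in> {..<n} \<and> k \<le> j. b j * of_nat (j choose k) * (- s0) ^ (j - k) * s ^ k)"
    by (auto simp: sum_distrib_right intro!: sum.cong)
  also have "\<dots> = (\<Sum>j<n. \<Sum>k | k \<in> {..<n} \<and> k \<le> j. b j * of_nat (j choose k) * (- s0) ^ (j - k) * s ^ k)"
    by (rule sum.swap_restrict) auto
  also have "\<dots> = (\<Sum>j<n. b j * (s + (- s0)) ^ j)"
  proof (intro sum.cong refl)
    fix j assume "j \<in> {..<n}"
    then have "{k. k \<in> {..<n} \<and> k \<le> j} = {..j}" by auto
    then show "(\<Sum>k | k \<in> {..<n} \<and> k \<le> j. b j * of_nat (j choose k) * (- s0) ^ (j - k) * s ^ k) = b j * (s + (- s0)) ^ j"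
      unfolding binomial_ring[of s "- s0"] by (simp add: sum_distrib_left mult_ac)
  qed
  finally show ?thesis by simp
qed

text \<open>Written in powers of s - s0, both polynomial parts match the explicit form of the
  integral term by term. Dividing by (n-1)! \<tau>^n normalises the leading coefficient to
  1.\<close>

lemma Delta_eq_beta_transform:
  assumes n: "n > 0" and \<tau>: "\<tau> > 0" and cc: "coeff_conditions n \<tau> a \<alpha> s0"
  defines "z \<equiv> \<lambda>s. complex_of_real \<tau> * (s - complex_of_real s0)"
  shows "Delta n \<tau> a \<alpha> s = z s ^ (2 * n) * exp (- z s / 2) * beta_transform n 0 (z s) / (fact (n - 1) * of_real \<tau> ^ n)"
proof -
  \<comment> \<open>\<open>b\<close> and \<open>\<beta>\<close> are the coefficients in powers of s
    - s0: of the part without delay apart from its leading term (s - s0)^n, and of the factor of exp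
    (-s \<tau>).\<close>
  define b where "b j = (-1) ^ (n - j) * fact (2 * n - j - 1) * real (n choose j) / (fact (n - 1) * \<tau> ^ (n - j))" for j
  define \<beta> where "\<beta> j = (-1) ^ (n - 1) * exp (s0 * \<tau>) * fact (2 * n - j - 1) * real ((n - 1) choose j) / (fact (n - 1) * \<tau> ^ (n - j))" for j
  have m1: "(- s0) ^ i = (-1) ^ i * s0 ^ i" for i by (rule power_minus)
  have a: "a k = real (n choose k) * (- s0) ^ (n - k) + (\<Sum>j = k..n - 1. b j * real (j choose k) * (- s0) ^ (j - k))" if "k < n" for k
  proof -
    have "a k = coeff_a n \<tau> s0 k" using cc that by (simp add: coeff_conditions_def)
    moreover have "(-1) ^ (n - k) * fact n * (real (j choose k) * real ((2 * n - j - 1) choose (n - 1)) * s0 ^ (j - k) / (fact j * \<tau> ^ (n - j)))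
        = b j * real (j choose k) * (- s0) ^ (j - k)" if j: "j \<in> {k..n - 1}" for j
    proof -
      have jn: "j < n" "k \<le> j" using j n by auto
      have "n - j = 2 * n - j - 1 - (n - 1)" using jn by auto
      then have 1: "real ((2 * n - j - 1) choose (n - 1)) = fact (2 * n - j - 1) / (fact (n - 1) * fact (n - j))"
        using jn by (subst binomial_fact) auto
      have 2: "real (n choose j) = fact n / (fact j * fact (n - j))"
        using jn by (subst binomial_fact) auto
      have 3: "(-1::real) ^ (n - k) = (-1) ^ (n - j) * (-1) ^ (j - k)"
        using jn by (simp flip: power_add)
      show ?thesis unfolding b_def 1 2 3 m1[of "j - k"] by (simp add: mult_ac)
    qed
    ultimately show ?thesis unfolding coeff_a_def sum_distrib_left by simp
  qed
  have \<alpha>: "\<alpha> k = (\<Sum>j = k..n - 1. \<beta> j * real (j choose k) * (- s0) ^ (j - k))" if "k < n" for k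
  proof -
    have "\<alpha> k = coeff_alpha n \<tau> s0 k" using cc that by (simp add: coeff_conditions_def)
    moreover have "(-1) ^ (n - 1) * exp (s0 * \<tau>) * ((-1) ^ (j - k) * fact (2 * n - j - 1)
                          / (fact k * fact (j - k) * fact (n - j - 1)) * s0 ^ (j - k) / \<tau> ^ (n - j))
        = \<beta> j * real (j choose k) * (- s0) ^ (j - k)" if j: "j \<in> {k..n - 1}" for j
    proof -
      have jn: "j < n" "k \<le> j" "j \<le> n - 1" using j n by auto
      have "n - 1 - j = n - j - 1" by auto
      then have 1: "real ((n - 1) choose j) = fact (n - 1) / (fact j * fact (n - j - 1))"
        using jn by (subst binomial_fact) auto
      have 2: "real (j choose k) = fact j / (fact k * fact (j - k))"
        using jn by (subst binomial_fact) auto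
      show ?thesis unfolding \<beta>_def 1 2 m1 by (simp add: mult_ac)
    qed
    ultimately show ?thesis unfolding coeff_alpha_def sum_distrib_left by simp
  qed
  have scale: "z s ^ j / of_real \<tau> ^ n = (s - of_real s0) ^ j / of_real \<tau> ^ (n - j)" if "j \<le> n" for j
  proof -
    have "complex_of_real \<tau> ^ n = of_real \<tau> ^ j * of_real \<tau> ^ (n - j)"
      using that by (simp flip: power_add)
    then show ?thesis using \<tau> by (simp add: z_def power_mult_distrib)
  qed
  have "s ^ n + (\<Sum>k<n. complex_of_real (a k) * s ^ k)
      = (\<Sum>k\<le>n. of_nat (n choose k) * (- of_real s0) ^ (n - k) * s ^ k)
        + (\<Sum>k<n. (\<Sum>j = k..n - 1. complex_of_real (b j) * of_nat (j choose k) * (- of_real s0) ^ (j - k)) * s ^ k)"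
    by (simp add: a ring_distribs sum.distrib lessThan_Suc_atMost[symmetric])
  also have "(\<Sum>k\<le>n. of_nat (n choose k) * (- of_real s0) ^ (n - k) * s ^ k) = (s + - of_real s0) ^ n"
    unfolding binomial_ring by (intro sum.cong) (auto simp: mult_ac)
  also have "\<dots> = fact (n - 1) * z s ^ n / (fact (n - 1) * of_real \<tau> ^ n)"
    using scale[of n] by simp
  also have "(\<Sum>k<n. (\<Sum>j = k..n - 1. complex_of_real (b j) * of_nat (j choose k) * (- of_real s0) ^ (j - k)) * s ^ k)
     = (\<Sum>j<n. (-1) ^ (n - j) * fact (2 * n - j - 1) * of_nat (n choose j) * z s ^ j) / (fact (n - 1) * of_real \<tau> ^ n)"
  proof -
    have "(\<Sum>j<n. complex_of_real (b j) * (s - of_real s0) ^ j)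
     = (\<Sum>j<n. (-1) ^ (n - j) * fact (2 * n - j - 1) * of_nat (n choose j) * (z s ^ j / of_real \<tau> ^ n) / fact (n - 1))"
      by (intro sum.cong) (auto simp: scale b_def)
    then show ?thesis unfolding sum_taylor_shift by (simp add: sum_divide_distrib mult_ac)
  qed
  finally have 1: "s ^ n + (\<Sum>k<n. complex_of_real (a k) * s ^ k) = 
     (fact (n - 1) * z s ^ n + (\<Sum>j<n. (-1) ^ (n - j) * fact (2 * n - j - 1) * of_nat (n choose j) * z s ^ j)) / (fact (n - 1) * of_real \<tau> ^ n)"
    by (simp add: add_divide_distrib)
  \<comment> \<open>The factor exp (s0 \<tau>) carried by every \<open>\<alpha> k\<close> recentres
    the exponential at s0.\<close>
  have e: "exp (- s * of_real \<tau>) * exp (of_real (s0 * \<tau>)) = exp (- z s)"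
    by (simp add: z_def algebra_simps flip: exp_add)
  have "(\<Sum>k<n. complex_of_real (\<alpha> k) * s ^ k) =
     (\<Sum>k<n. (\<Sum>j = k..n - 1. complex_of_real (\<beta> j) * of_nat (j choose k) * (- of_real s0) ^ (j - k)) * s ^ k)"
    by (simp add: \<alpha>)
  also have "\<dots> = (\<Sum>j<n. complex_of_real (\<beta> j) * (s - of_real s0) ^ j)"
    by (rule sum_taylor_shift)
  also have "\<dots> = (\<Sum>j<n. - exp (of_real (s0 * \<tau>)) * ((-1) ^ n * fact (2 * n - j - 1) * of_nat ((n - 1) choose j) * (z s ^ j / of_real \<tau> ^ n)) / fact (n - 1))"
  proof -
    have "(-1::complex) ^ n = - ((-1) ^ (n - 1))" using n by (cases n) auto
    then show ?thesis by (intro sum.cong) (auto simp: scale \<beta>_def mult_ac simp flip: exp_of_real)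
  qed
  also have "\<dots> = - exp (of_real (s0 * \<tau>)) * (\<Sum>j<n. (-1) ^ n * fact (2 * n - j - 1) * of_nat ((n - 1) choose j) * z s ^ j) / (fact (n - 1) * of_real \<tau> ^ n)"
    unfolding sum_distrib_left sum_divide_distrib by (intro sum.cong) auto
  finally have 2: "exp (- s * complex_of_real \<tau>) * (\<Sum>k<n. complex_of_real (\<alpha> k) * s ^ k) = - exp (- z s) * 
    (\<Sum>j<n. (-1) ^ n * fact (2 * n - j - 1) * of_nat ((n - 1) choose j) * z s ^ j) / (fact (n - 1) * of_real \<tau> ^ n)"
    by (simp flip: e)
  show ?thesis
    unfolding Delta_def 1 2 beta_transform_explicit[OF n] by (simp add: diff_divide_distrib)
qed

lemma Delta_root_Re_less:
  assumes n: "n > 0" and \<tau>: "\<tau> > 0" and cc: "coeff_conditions n \<tau> a \<alpha> s0"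
    and "Delta n \<tau> a \<alpha> s = 0" "s \<noteq> complex_of_real s0"
  shows "Re s < s0"
proof -
  have "beta_transform n 0 (complex_of_real \<tau> * (s - complex_of_real s0)) = 0"
    using assms Delta_eq_beta_transform[OF n \<tau> cc, of s] by auto
  from beta_transform_zero_Re_neg[OF n this] have "\<tau> * (Re s - s0) < 0" by simp
  then show ?thesis using \<tau> by (simp add: mult_less_0_iff)
qed

text \<open>Each derivative lowers the power of s - c by one and leaves an entire cofactor, so after
  k < m steps a positive power remains.\<close>

lemma higher_deriv_zero_of_power_factor:
  assumes "G holomorphic_on UNIV" "k < m"
  shows "(deriv ^^ k) (\<lambda>s. (s - c) ^ m * G s) c = 0"
proof -
  have "\<exists>H. H holomorphic_on UNIV \<and> (deriv ^^ k) (\<lambda>s. (s - c) ^ m * G s) = (\<lambda>s. (s - c) ^ (m - k) * H s)"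
    if "k \<le> m" for k
    using that
  proof (induction k)
    case (Suc k)
    then obtain H where H: "H holomorphic_on UNIV"
        "(deriv ^^ k) (\<lambda>s. (s - c) ^ m * G s) = (\<lambda>s. (s - c) ^ (m - k) * H s)" by auto
    obtain l where l: "m - k = Suc l" "m - Suc k = l" using Suc.prems by (metis Suc_diff_Suc Suc_le_lessD)
    let ?H = "\<lambda>s. of_nat (Suc l) * H s + (s - c) * deriv H s"
    have "deriv (\<lambda>s. (s - c) ^ Suc l * H s) s = (s - c) ^ l * ?H s" for s
    proof (rule DERIV_imp_deriv)
      have "((\<lambda>s. (s - c) ^ Suc l) has_field_derivative of_nat (Suc l) * (s - c) ^ l) (at s)"
        by (auto intro!: derivative_eq_intros simp del: power_Suc)
      moreover have "(H has_field_derivative deriv H s) (at s)"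
        using H(1) by (intro holomorphic_derivI[of _ UNIV]) auto
      ultimately show "((\<lambda>s. (s - c) ^ Suc l * H s) has_field_derivative (s - c) ^ l * ?H s) (at s)"
        by (rule DERIV_mult[THEN DERIV_cong]) (simp add: algebra_simps)
    qed
    moreover have "?H holomorphic_on UNIV"
      using H(1) by (intro holomorphic_intros) auto
    ultimately show ?case using H(2) l by (intro exI[of _ ?H]) auto
  qed (use assms in auto)
  from this[of k] assms show ?thesis by auto
qed

lemma root_mult_2n_if_coeff_conditions:
  assumes n: "n > 0" and \<tau>: "\<tau> > 0" and cc: "coeff_conditions n \<tau> a \<alpha> s0"
  shows "root_mult_2n n \<tau> a \<alpha> (complex_of_real s0)"
proof -
  let ?z = "\<lambda>s. complex_of_real \<tau> * (s - complex_of_real s0)"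
  let ?G = "\<lambda>s. of_real \<tau> ^ (2 * n) * exp (- ?z s / 2) * beta_transform n 0 (?z s) / (fact (n - 1) * of_real \<tau> ^ n)"
  have "beta_transform n 0 holomorphic_on UNIV"
    using beta_transform_has_field_derivative by (meson field_differentiable_at_within field_differentiable_def holomorphic_onI)
  then have "(beta_transform n 0 \<circ> ?z) holomorphic_on UNIV"
    by (intro holomorphic_on_compose holomorphic_intros) (auto intro: holomorphic_on_subset)
  then have hol: "?G holomorphic_on UNIV"
    using \<tau> by (intro holomorphic_intros) (auto simp: o_def)
  have eq: "Delta n \<tau> a \<alpha> = (\<lambda>s. (s - complex_of_real s0) ^ (2 * n) * ?G s)"
    by (intro ext, subst Delta_eq_beta_transform[OF n \<tau> cc]) (simp add: power_mult_distrib)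
  show ?thesis
    unfolding root_mult_2n_def eq using higher_deriv_zero_of_power_factor[OF hol] by blast
qed

section \<open>Quasipolynomials with a zero of order 2n, and uniqueness of the coefficients\<close>

definition pderiv_exp :: "complex \<Rightarrow> complex poly \<Rightarrow> complex poly" where
  "pderiv_exp c q = pderiv q - smult c q"

text \<open>Product rule: differentiating exp (-s c) q(s) replaces q by q' - c q, so
  \<open>pderiv_exp c\<close> is the operator D - c.\<close>

lemma higher_deriv_quasipolynomial:
  "(deriv ^^ k) (\<lambda>s. poly p s + exp (- s * c) * poly q s)
     = (\<lambda>s. poly ((pderiv ^^ k) p) s + exp (- s * c) * poly ((pderiv_exp c ^^ k) q) s)"
proof (induction k)
  case (Suc k)
  show ?case
    unfolding funpow.simps o_apply Suc.IH
    by (rule ext, rule DERIV_imp_deriv)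
       (auto intro!: derivative_eq_intros simp: pderiv_exp_def algebra_simps)
qed auto

text \<open>Differentiation lowers the degree, so the top coefficient is multiplied by -c and cannot
  cancel.\<close>

lemma pderiv_exp_eq_0_iff:
  assumes "c \<noteq> 0"
  shows "pderiv_exp c q = 0 \<longleftrightarrow> q = 0"
proof
  assume "pderiv_exp c q = 0"
  then have "coeff (pderiv_exp c q) (degree q) = 0" by simp
  then show "q = 0"
    using assms by (simp add: pderiv_exp_def coeff_pderiv coeff_eq_0)
qed (simp add: pderiv_exp_def)

lemma degree_pderiv_exp_le: "degree (pderiv_exp c q) \<le> degree q"
  unfolding pderiv_exp_def by (intro degree_diff_le) (auto simp: degree_pderiv)

text \<open>Since D = (D - c) + c, each D^i is a combination of the powers (D - c)^j with j <= i.
  The induction is applied both to \<open>r\<close> and to (D - c) \<open>r\<close>.\<close>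

lemma higher_pderiv_eq_0_if_pderiv_exp:
  assumes "\<And>j. j \<le> i \<Longrightarrow> poly ((pderiv_exp c ^^ j) r) x = 0"
  shows "poly ((pderiv ^^ i) r) x = 0"
  using assms
proof (induction i arbitrary: r)
  case (Suc i)
  have "poly ((pderiv ^^ i) (pderiv_exp c r)) x = 0"
    using Suc.prems[of "Suc _"] by (intro Suc.IH) (simp add: funpow_Suc_right del: funpow.simps)
  moreover have "poly ((pderiv ^^ i) r) x = 0"
    using Suc.prems by (intro Suc.IH) auto
  moreover have "pderiv r = pderiv_exp c r + smult c r" by (simp add: pderiv_exp_def)
  then have "(pderiv ^^ Suc i) r = (pderiv ^^ i) (pderiv_exp c r) + smult c ((pderiv ^^ i) r)"
    by (simp add: funpow_Suc_right higher_pderiv_add higher_pderiv_smult del: funpow.simps)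
  ultimately show ?case by simp
qed auto

lemma poly_eq_0_if_higher_pderiv_eq_0:
  fixes r :: "complex poly"
  assumes "degree r < N" "\<And>i. i < N \<Longrightarrow> poly ((pderiv ^^ i) r) x = 0"
  shows "r = 0"
proof -
  have "coeff (r \<circ>\<^sub>p [:x, 1:]) i = 0" for i
  proof (cases "i < N")
    case True
    then show ?thesis using assms(2)[of i] by (simp add: poly_higher_pderiv_conv_coeff)
  next
    case False
    then show ?thesis using assms(1) by (intro coeff_eq_0) (simp add: degree_pcompose)
  qed
  then have "r \<circ>\<^sub>p [:x, 1:] = 0" by (intro poly_eqI) simp
  then show ?thesis by (simp add: pcompose_eq_0_iff)
qed

text \<open>Derivatives of order n and higher annihilate \<open>p\<close>. The n conditions of order
  n to 2n - 1 thus concern only r = (D - c)^n q, whose degree is below n; hence r = 0, and q = 0 by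
  injectivity of D - c. The first n conditions then give p = 0.\<close>

lemma quasipolynomial_eq_0:
  fixes p q :: "complex poly" and c :: complex
  assumes n: "n > 0" and c: "c \<noteq> 0" and deg: "degree p < n" "degree q < n"
    and zero: "\<And>k. k < 2 * n \<Longrightarrow> (deriv ^^ k) (\<lambda>s. poly p s + exp (- s * c) * poly q s) x = 0"
  shows "p = 0" "q = 0"
proof -
  have 1: "poly ((pderiv ^^ k) p) x + exp (- x * c) * poly ((pderiv_exp c ^^ k) q) x = 0" if "k < 2 * n" for k
    using zero[OF that] unfolding higher_deriv_quasipolynomial .
  define r where "r = (pderiv_exp c ^^ n) q"
  have "degree ((pderiv_exp c ^^ k) q) \<le> degree q" for k
    by (induction k) (auto intro: order.trans[OF degree_pderiv_exp_le])
  then have degr: "degree r < n" unfolding r_def using deg(2) order.strict_trans1 by blast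
  have p0: "(pderiv ^^ k) p = 0" if "k \<ge> n" for k
    using that deg(1) by (intro poly_eqI) (simp add: coeff_higher_pderiv coeff_eq_0)
  have "poly ((pderiv_exp c ^^ i) r) x = 0" if "i < n" for i
    using 1[of "i + n"] that by (simp add: p0 r_def funpow_add)
  then have "r = 0"
    using degr by (intro poly_eq_0_if_higher_pderiv_eq_0[of r n x] higher_pderiv_eq_0_if_pderiv_exp[of _ c]) auto
  moreover have "(pderiv_exp c ^^ k) q = 0 \<longleftrightarrow> q = 0" for k
    by (induction k) (simp_all add: pderiv_exp_eq_0_iff c)
  ultimately show q: "q = 0" unfolding r_def by blast
  have "(pderiv_exp c ^^ k) 0 = 0" for k
    by (induction k) (simp_all add: pderiv_exp_def)
  then have "poly ((pderiv ^^ i) p) x = 0" if "i < n" for i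
    using 1[of i] that q by simp
  then show "p = 0" using deg(1) poly_eq_0_if_higher_pderiv_eq_0 by blast
qed

lemma Delta_holomorphic: "Delta n \<tau> a \<alpha> holomorphic_on S"
  unfolding Delta_def[abs_def] by (intro holomorphic_intros)

text \<open>In the difference of the two quasipolynomials s^n cancels, leaving polynomials of degree
  below n and a zero of order 2n.\<close>

lemma root_mult_2n_unique:
  assumes n: "n > 0" and \<tau>: "\<tau> > 0"
    and "root_mult_2n n \<tau> a \<alpha> c" "root_mult_2n n \<tau> a' \<alpha>' c" "k < n"
  shows "a k = a' k" "\<alpha> k = \<alpha>' k"
proof -
  define P :: "(nat \<Rightarrow> real) \<Rightarrow> complex poly" where "P f = (\<Sum>k<n. monom (of_real (f k)) k)" for f
  have deg: "degree (P f) < n" for f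
    unfolding P_def using n by (intro degree_sum_less) (auto intro: le_less_trans[OF degree_monom_le])
  have coeff: "coeff (P f) k = of_real (f k)" for f
    using \<open>k < n\<close> unfolding P_def by (simp add: coeff_sum if_distrib cong: if_cong)
  have poly: "poly (P f) s = (\<Sum>k<n. of_real (f k) * s ^ k)" for f s
    unfolding P_def by (simp add: poly_sum poly_monom)
  let ?p = "P (\<lambda>k. a k - a' k)" and ?q = "P (\<lambda>k. \<alpha> k - \<alpha>' k)"
  have "(\<lambda>s. poly ?p s + exp (- s * of_real \<tau>) * poly ?q s) = (\<lambda>s. Delta n \<tau> a \<alpha> s - Delta n \<tau> a' \<alpha>' s)"
    by (rule ext) (simp add: Delta_def poly algebra_simps sum_subtractf)
  then have "(deriv ^^ i) (\<lambda>s. poly ?p s + exp (- s * of_real \<tau>) * poly ?q s) c = 0" if "i < 2 * n" for i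
    using that assms(3,4) higher_deriv_diff[OF Delta_holomorphic Delta_holomorphic, of UNIV c i]
    by (simp add: root_mult_2n_def)
  from quasipolynomial_eq_0[OF n _ deg deg this] have "?p = 0" "?q = 0" using \<tau> by auto
  then have "coeff ?p k = 0" "coeff ?q k = 0" by simp_all
  then show "a k = a' k" "\<alpha> k = \<alpha>' k" by (simp_all add: coeff)
qed

text \<open>For the forward direction, the stated coefficients are themselves a solution of the
  multiplicity condition, hence the only one.\<close>

lemma root_mult_2n_iff_coeff_conditions:
  assumes n: "n > 0" and \<tau>: "\<tau> > 0"
  shows "root_mult_2n n \<tau> a \<alpha> (complex_of_real s0) \<longleftrightarrow> coeff_conditions n \<tau> a \<alpha> s0"
proof
  assume "root_mult_2n n \<tau> a \<alpha> (complex_of_real s0)"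
  moreover have "root_mult_2n n \<tau> (coeff_a n \<tau> s0) (coeff_alpha n \<tau> s0) (complex_of_real s0)"
    by (rule root_mult_2n_if_coeff_conditions[OF n \<tau>]) (simp add: coeff_conditions_def)
  ultimately show "coeff_conditions n \<tau> a \<alpha> s0"
    unfolding coeff_conditions_def using root_mult_2n_unique[OF n \<tau>] by blast
qed (rule root_mult_2n_if_coeff_conditions[OF n \<tau>])

subsection \<open>Twisted boundary value problems\<close>

text \<open>v = exp (-l \<theta>) u is nearly constant, its derivative being the residual times an
  exponential bounded by \<open>E\<close>. The boundary condition then determines u(0) up to
  division by 1 - \<zeta> exp (l \<tau>). The constant depends on \<open>l\<close> and
  \<open>\<zeta>\<close> only through \<open>L\<close>, \<open>r\<close> and
  \<open>\<delta>\<close>.\<close>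

lemma first_order_twisted_bound:
  fixes u u' :: "real \<Rightarrow> complex"
  assumes \<tau>: "\<tau> > 0" and \<delta>: "\<delta> > 0" "\<delta> \<le> norm (1 - \<zeta> * exp (l * of_real \<tau>))"
    and L: "norm l \<le> L" and r: "norm \<zeta> \<le> r"
    and du: "\<And>\<theta>. \<theta> \<in> {0..\<tau>} \<Longrightarrow> (u has_vector_derivative u' \<theta>) (at \<theta> within {0..\<tau>})"
    and B: "\<And>\<theta>. \<theta> \<in> {0..\<tau>} \<Longrightarrow> norm (u' \<theta> - l * u \<theta>) \<le> B" "norm (u 0 - \<zeta> * u \<tau>) \<le> B"
    and \<theta>: "\<theta> \<in> {0..\<tau>}"
  defines "E \<equiv> exp (L * \<tau>)"
  shows "norm (u \<theta>) \<le> E * ((1 + r * E * (E * \<tau>)) / \<delta> + E * \<tau>) * B"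
proof -
  define v where "v \<theta> = exp (- l * of_real \<theta>) * u \<theta>" for \<theta>
  have exp_le: "norm (exp (x * of_real t)) \<le> E" if "t \<in> {0..\<tau>}" "norm x \<le> L" for x :: complex and t
  proof -
    have "norm (x * of_real t) \<le> L * \<tau>"
      using that \<tau> by (auto simp: norm_mult intro!: mult_mono order.trans[OF norm_ge_zero])
    then show ?thesis unfolding E_def using norm_exp[of "x * of_real t"] by (meson exp_le_cancel_iff order.trans)
  qed
  have B0: "B \<ge> 0" using B(2) norm_ge_zero order.trans by blast
  have E0: "E > 0" unfolding E_def by simp
  have r0: "r \<ge> 0" using r norm_ge_zero order.trans by blast
  have dv: "(v has_vector_derivative exp (- l * of_real t) * (u' t - l * u t)) (at t within {0..\<tau>})"
    if "t \<in> {0..\<tau>}" for t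
  proof -
    have "((\<lambda>t. exp (- l * of_real t)) has_vector_derivative - l * exp (- l * of_real t)) (at t within {0..\<tau>})"
      by (rule has_vector_derivative_real_field) (auto intro!: derivative_eq_intros)
    from has_vector_derivative_mult[OF this du[OF that]] show ?thesis
      by (simp add: v_def[abs_def] algebra_simps)
  qed
  have v: "norm (v t - v 0) \<le> E * \<tau> * B" if t: "t \<in> {0..\<tau>}" for t
  proof -
    have "norm (v t - v 0) \<le> (E * B) * norm (t - 0)"
    proof (rule differentiable_bound)
      show "(v has_derivative (\<lambda>h. h *\<^sub>R (exp (- l * of_real x) * (u' x - l * u x)))) (at x within {0..\<tau>})"
        if "x \<in> {0..\<tau>}" for x using dv[OF that] by (simp add: has_vector_derivative_def)
      show "onorm (\<lambda>h. h *\<^sub>R (exp (- l * of_real x) * (u' x - l * u x))) \<le> E * B"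
        if x: "x \<in> {0..\<tau>}" for x
      proof (rule onorm_le)
        fix h :: real
        have "norm (exp (- l * of_real x) * (u' x - l * u x)) \<le> E * B"
          unfolding norm_mult using exp_le[OF x, of "- l"] L B(1)[OF x] E0 by (intro mult_mono) auto
        then show "norm (h *\<^sub>R (exp (- l * of_real x) * (u' x - l * u x))) \<le> E * B * norm h"
          by (simp add: mult_left_mono mult.commute)
      qed
    qed (use t \<tau> in auto)
    also have "\<dots> \<le> E * B * \<tau>"
      using t E0 B0 by (intro mult_left_mono) auto
    finally show ?thesis by (simp add: mult_ac)
  qed
  have u: "u t = exp (l * of_real t) * v t" for t
    unfolding v_def by (simp flip: mult.assoc exp_add)
  \<comment> \<open>Insert u(\<tau>) = exp (l \<tau>) v(\<tau>) and v(0) = u(0) to isolate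
    u(0).\<close>
  have "u 0 * (1 - \<zeta> * exp (l * of_real \<tau>)) = (u 0 - \<zeta> * u \<tau>) + \<zeta> * exp (l * of_real \<tau>) * (v \<tau> - v 0)"
    by (simp add: u algebra_simps)
  also have "norm \<dots> \<le> B + r * E * (E * \<tau> * B)"
    using B(2) r exp_le[OF _ L, of \<tau>] v[of \<tau>] \<tau> r0 E0
    by (intro order.trans[OF norm_triangle_ineq] add_mono) (auto simp: norm_mult intro!: mult_mono)
  finally have "norm (u 0) * \<delta> \<le> B + r * E * (E * \<tau> * B)"
    using \<delta>(2) unfolding norm_mult by (meson mult_left_mono norm_ge_zero order.trans)
  then have u0: "norm (u 0) \<le> (1 + r * E * (E * \<tau>)) / \<delta> * B"
    using \<delta>(1) by (simp add: field_simps)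
  have "norm (v \<theta>) \<le> norm (v 0) + norm (v \<theta> - v 0)"
    using norm_triangle_ineq[of "v 0" "v \<theta> - v 0"] by simp
  also have "\<dots> \<le> (1 + r * E * (E * \<tau>)) / \<delta> * B + E * \<tau> * B"
    using u0 v[OF \<theta>] by (intro add_mono) (simp_all add: v_def)
  finally have "norm (v \<theta>) \<le> ((1 + r * E * (E * \<tau>)) / \<delta> + E * \<tau>) * B"
    by (simp add: algebra_simps)
  then have "norm (u \<theta>) \<le> E * (((1 + r * E * (E * \<tau>)) / \<delta> + E * \<tau>) * B)"
    unfolding u norm_mult using exp_le[OF \<theta> L] E0 by (intro mult_mono) auto
  then show ?thesis by (simp only: mult.assoc)
qed

text \<open>Uniformity of the constant over all characteristic polynomials is essential; it is
  obtained by splitting off one linear factor \<open>D - \<lambda>\<close> at a time.\<close>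

lemma twisted_ode_bound:
  assumes \<tau>: "\<tau> > 0" and \<delta>: "\<delta> > 0" and L: "L \<ge> 0" and r: "r \<ge> 0"
  shows "\<exists>C \<ge> 0. \<forall>p \<zeta> u B. degree p = n \<longrightarrow> lead_coeff p = 1 \<longrightarrow> norm \<zeta> \<le> r \<longrightarrow>
     (\<forall>l. poly p l = 0 \<longrightarrow> norm l \<le> L \<and> \<delta> \<le> norm (1 - \<zeta> * exp (l * of_real \<tau>))) \<longrightarrow>
     (\<forall>k<n. \<forall>\<theta>\<in>{0..\<tau>}. (u k has_vector_derivative u (Suc k) \<theta>) (at \<theta> within {0..\<tau>})) \<longrightarrow>
     (\<forall>\<theta>\<in>{0..\<tau>}. norm (\<Sum>k\<le>n. coeff p k * u k \<theta>) \<le> B) \<longrightarrow>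
     (\<forall>k<n. norm (u k 0 - \<zeta> * u k \<tau>) \<le> B) \<longrightarrow>
     (\<forall>k\<le>n. \<forall>\<theta>\<in>{0..\<tau>}. norm (u k \<theta> :: complex) \<le> C * B)"
proof (induction n)
  case 0
  \<comment> \<open>Here p = 1, and the residual is u itself.\<close>
  show ?case by (rule exI[of _ 1]) auto
next
  case (Suc n)
  then obtain C where C: "C \<ge> 0"
    and bound: "\<forall>p \<zeta> u B. degree p = n \<longrightarrow> lead_coeff p = 1 \<longrightarrow> norm \<zeta> \<le> r \<longrightarrow>
     (\<forall>l. poly p l = 0 \<longrightarrow> norm l \<le> L \<and> \<delta> \<le> norm (1 - \<zeta> * exp (l * of_real \<tau>))) \<longrightarrow>
     (\<forall>k<n. \<forall>\<theta>\<in>{0..\<tau>}. (u k has_vector_derivative u (Suc k) \<theta>) (at \<theta> within {0..\<tau>})) \<longrightarrow>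
     (\<forall>\<theta>\<in>{0..\<tau>}. norm (\<Sum>k\<le>n. coeff p k * u k \<theta>) \<le> B) \<longrightarrow>
     (\<forall>k<n. norm (u k 0 - \<zeta> * u k \<tau>) \<le> B) \<longrightarrow>
     (\<forall>k\<le>n. \<forall>\<theta>\<in>{0..\<tau>}. norm (u k \<theta> :: complex) \<le> C * B)"
    by (elim exE conjE) (rule that)
  note IH = bound[rule_format]
  define E where "E = exp (L * \<tau>)"
  define K where "K = E * ((1 + r * E * (E * \<tau>)) / \<delta> + E * \<tau>)"
  have E: "E > 0" by (simp add: E_def)
  have K: "K \<ge> 0" unfolding K_def using E \<delta> r \<tau> by simp
  define C1 where "C1 = C * (1 + L)"
  have C1: "C1 \<ge> 0" unfolding C1_def using C L by simp
  \<comment> \<open>The start value is the first-order bound for data (C1 + 1) B; the recursion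
    follows u_(k+1) = v_k + l u_k with |v_k| <= C1 B.\<close>
  define M where "M k = (rec_nat (K * (C1 + 1)) (\<lambda>_ x. C1 + L * x) k :: real)" for k
  have M_simps: "M 0 = K * (C1 + 1)" "M (Suc k) = C1 + L * M k" for k by (simp_all add: M_def)
  have M: "M k \<ge> 0" for k by (induction k) (use K C1 L in \<open>auto simp: M_simps\<close>)
  have main: "norm (u k \<theta>) \<le> M k * B"
    if p: "degree p = Suc n" "lead_coeff p = 1" and \<zeta>: "norm \<zeta> \<le> r"
      and roots: "\<And>l. poly p l = 0 \<Longrightarrow> norm l \<le> L \<and> \<delta> \<le> norm (1 - \<zeta> * exp (l * of_real \<tau>))"
      and du: "\<And>k \<theta>. k < Suc n \<Longrightarrow> \<theta>\<in>{0..\<tau>} \<Longrightarrow> (u k has_vector_derivative u (Suc k) \<theta>) (at \<theta> within {0..\<tau>})"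
      and B: "\<And>\<theta>. \<theta>\<in>{0..\<tau>} \<Longrightarrow> norm (\<Sum>k\<le>Suc n. coeff p k * u k \<theta>) \<le> B"
      and bc: "\<And>k. k < Suc n \<Longrightarrow> norm (u k 0 - \<zeta> * u k \<tau>) \<le> B"
      and k: "k \<le> Suc n" and \<theta>: "\<theta> \<in> {0..\<tau>}"
    for p \<zeta> B k \<theta> and u :: "nat \<Rightarrow> real \<Rightarrow> complex"
  proof -
    have B0: "B \<ge> 0" using bc[of 0] norm_ge_zero order.trans by blast
    obtain l where l: "poly p l = 0"
      using alg_closed_imp_poly_has_root[of p] p(1) by auto
    then obtain p' where p': "p = [:- l, 1:] * p'" by (metis dvd_def poly_eq_0_iff_dvd)
    then have "p' \<noteq> 0" using p(1) by auto
    then have degp': "degree p' = n" using p(1) unfolding p' by (subst (asm) degree_mult_eq) auto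
    have lead: "lead_coeff p' = 1" using p(2) unfolding p' lead_coeff_mult by simp
    have coeff_p: "coeff p k = (case k of 0 \<Rightarrow> 0 | Suc j \<Rightarrow> coeff p' j) - l * coeff p' k" for k
      unfolding p' by (simp add: coeff_pCons split: nat.split)
    \<comment> \<open>v = (D - l) u solves the equation of the quotient \<open>p'\<close> with the
      same residual, and its boundary defect is at most (1 + L) B.\<close>
    define v where "v k \<theta> = u (Suc k) \<theta> - l * u k \<theta>" for k \<theta>
    have vsum: "(\<Sum>k\<le>n. coeff p' k * v k \<theta>) = (\<Sum>k\<le>Suc n. coeff p k * u k \<theta>)" for \<theta>
    proof -
      have "(\<Sum>k\<le>Suc n. coeff p k * u k \<theta>) = (\<Sum>k\<le>Suc n. (case k of 0 \<Rightarrow> 0 | Suc j \<Rightarrow> coeff p' j) * u k \<theta>)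
           - (\<Sum>k\<le>Suc n. l * coeff p' k * u k \<theta>)"
        by (simp only: coeff_p left_diff_distrib sum_subtractf)
      also have "(\<Sum>k\<le>Suc n. (case k of 0 \<Rightarrow> 0 | Suc j \<Rightarrow> coeff p' j) * u k \<theta>) = (\<Sum>k\<le>n. coeff p' k * u (Suc k) \<theta>)"
        by (subst sum.atMost_Suc_shift) simp
      also have "(\<Sum>k\<le>Suc n. l * coeff p' k * u k \<theta>) = (\<Sum>k\<le>n. l * coeff p' k * u k \<theta>)"
        using degp' by (simp add: coeff_eq_0)
      finally show ?thesis by (simp add: v_def algebra_simps sum_subtractf)
    qed
    have rootsp': "norm \<mu> \<le> L \<and> \<delta> \<le> norm (1 - \<zeta> * exp (\<mu> * of_real \<tau>))" if "poly p' \<mu> = 0" for \<mu>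
      using roots[of \<mu>] that by (simp add: p')
    have lL: "norm l \<le> L" using roots[OF l] by simp
    have v: "norm (v k \<theta>) \<le> C1 * B" if "k \<le> n" "\<theta> \<in> {0..\<tau>}" for k \<theta>
    proof -
      have "norm (v k \<theta>) \<le> C * ((1 + L) * B)"
      proof (rule IH[OF degp' lead \<zeta> rootsp' _ _ _ that])
        show "(v k has_vector_derivative v (Suc k) \<theta>) (at \<theta> within {0..\<tau>})" if "k < n" "\<theta>\<in>{0..\<tau>}" for k \<theta>
          unfolding v_def using that by (intro has_vector_derivative_diff has_vector_derivative_mult_right du) auto
        have BB: "B \<le> (1 + L) * B" using B0 L by (simp add: distrib_right)
        show "norm (\<Sum>k\<le>n. coeff p' k * v k \<theta>) \<le> (1 + L) * B" if "\<theta>\<in>{0..\<tau>}" for \<theta>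
          unfolding vsum using B[OF that] BB by simp
        show "norm (v k 0 - \<zeta> * v k \<tau>) \<le> (1 + L) * B" if "k < n" for k
        proof -
          have "v k 0 - \<zeta> * v k \<tau> = (u (Suc k) 0 - \<zeta> * u (Suc k) \<tau>) - l * (u k 0 - \<zeta> * u k \<tau>)"
            by (simp add: v_def algebra_simps)
          also have "norm \<dots> \<le> B + L * B"
          proof (rule order.trans[OF norm_triangle_ineq4 add_mono])
            show "norm (l * (u k 0 - \<zeta> * u k \<tau>)) \<le> L * B"
              unfolding norm_mult[of l] using bc[of k] that lL L by (intro mult_mono) auto
          qed (use bc that in auto)
          finally show ?thesis by (simp add: distrib_right)
        qed
      qed auto
      then show ?thesis by (simp add: C1_def mult_ac)
    qed
    show ?thesis using k \<theta>
    proof (induction k arbitrary: \<theta>)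
      case 0
      \<comment> \<open>Now solve u' - l u = v_0. The data (C1 + 1) B dominates both the right-hand
        side, at most C1 B, and the boundary defect, at most B.\<close>
      have "norm (u 0 \<theta>) \<le> K * ((C1 + 1) * B)"
        unfolding K_def E_def
      proof (rule first_order_twisted_bound[OF \<tau> \<delta> _ lL \<zeta> _ _ _ 0(2)])
        show "\<delta> \<le> norm (1 - \<zeta> * exp (l * of_real \<tau>))" using roots[OF l] by simp
        show "(u 0 has_vector_derivative u (Suc 0) \<theta>) (at \<theta> within {0..\<tau>})" if "\<theta> \<in> {0..\<tau>}" for \<theta>
          using du[OF _ that] by simp
        show "norm (u (Suc 0) \<theta> - l * u 0 \<theta>) \<le> (C1 + 1) * B" if "\<theta> \<in> {0..\<tau>}" for \<theta>
          using v[OF _ that, of 0] B0 by (simp add: v_def distrib_right)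
        show "norm (u 0 0 - \<zeta> * u 0 \<tau>) \<le> (C1 + 1) * B"
        proof -
          have "0 \<le> C1 * B" using C1 B0 by simp
          then show ?thesis using bc[of 0] by (simp add: distrib_right)
        qed
      qed
      then show ?case by (simp add: M_simps mult_ac)
    next
      case (Suc k)
      have "u (Suc k) \<theta> = v k \<theta> + l * u k \<theta>" by (simp add: v_def)
      also have "norm \<dots> \<le> C1 * B + L * (M k * B)"
      proof (rule order.trans[OF norm_triangle_ineq add_mono])
        show "norm (l * u k \<theta>) \<le> L * (M k * B)"
          unfolding norm_mult using Suc lL L by (intro mult_mono) auto
      qed (use v Suc.prems in auto)
      finally show ?case by (simp add: M_simps algebra_simps)
    qed
  qed
  define C' where "C' = (\<Sum>k\<le>Suc n. M k)"
  have MC: "M k \<le> C'" if "k \<le> Suc n" for k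
    unfolding C'_def using that M by (intro member_le_sum) auto
  show ?case
  proof (intro exI[of _ C'] conjI allI impI ballI)
    show "C' \<ge> 0" unfolding C'_def using M by (intro sum_nonneg) auto
    fix p \<zeta> B k \<theta> and u :: "nat \<Rightarrow> real \<Rightarrow> complex"
    assume *: "degree p = Suc n" "lead_coeff p = 1" "norm \<zeta> \<le> r"
      "\<forall>l. poly p l = 0 \<longrightarrow> norm l \<le> L \<and> \<delta> \<le> norm (1 - \<zeta> * exp (l * of_real \<tau>))"
      "\<forall>k<Suc n. \<forall>\<theta>\<in>{0..\<tau>}. (u k has_vector_derivative u (Suc k) \<theta>) (at \<theta> within {0..\<tau>})"
      "\<forall>\<theta>\<in>{0..\<tau>}. norm (\<Sum>k\<le>Suc n. coeff p k * u k \<theta>) \<le> B"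
      "\<forall>k<Suc n. norm (u k 0 - \<zeta> * u k \<tau>) \<le> B" "k \<le> Suc n" "\<theta> \<in> {0..\<tau>}"
    then have "norm (u k \<theta>) \<le> M k * B" by (intro main[of p \<zeta>]) auto
    also have "\<dots> \<le> C' * B"
    proof (intro mult_right_mono MC)
      show "B \<ge> 0" using *(7) norm_ge_zero order.trans by blast
    qed (use * in auto)
    finally show "norm (u k \<theta>) \<le> C' * B" .
  qed
qed

text \<open>If |l| exceeded the bound, it would exceed 1 and the sum of the |c_k|, and the lower
  terms would be smaller than |l|^n.\<close>

lemma monic_root_bound:
  fixes c :: "nat \<Rightarrow> complex"
  assumes "l ^ n + (\<Sum>k<n. c k * l ^ k) = 0"
  shows "norm l \<le> 1 + (\<Sum>k<n. norm (c k))"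
proof (rule ccontr)
  assume "\<not> ?thesis"
  then have gt: "norm l > 1 + (\<Sum>k<n. norm (c k))" by simp
  moreover have "(\<Sum>k<n. norm (c k)) \<ge> 0" by (intro sum_nonneg) auto
  ultimately have 1: "norm l > 1" by simp
  have n: "n > 0" using assms by (cases n) auto
  have "norm l ^ n = norm (l ^ n)" by (simp add: norm_power)
  also have "l ^ n = - (\<Sum>k<n. c k * l ^ k)" using assms by (simp add: eq_neg_iff_add_eq_0)
  also have "norm \<dots> \<le> (\<Sum>k<n. norm (c k) * norm l ^ (n - 1))"
    unfolding norm_minus_cancel
    by (intro order.trans[OF norm_sum] sum_mono)
       (use 1 in \<open>auto simp: norm_mult norm_power intro!: mult_left_mono power_increasing\<close>)
  also have "\<dots> = (\<Sum>k<n. norm (c k)) * norm l ^ (n - 1)" by (simp add: sum_distrib_right)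
  also have "\<dots> < norm l * norm l ^ (n - 1)"
    using gt 1 by (intro mult_strict_right_mono zero_less_power) auto
  also have "\<dots> = norm l ^ n" using n by (cases n) auto
  finally show False by simp
qed

text \<open>Writing \<open>\<zeta>\<close> for \<open>exp (- s \<tau>)\<close>, a root of the characteristic polynomial for fixed \<open>\<zeta>\<close> at which the twisted
  boundary condition degenerates is exactly a root of \<^const>\<open>Delta\<close>.\<close>

lemma delay_twisted_bound:
  assumes \<tau>: "\<tau> > 0" and r: "r \<ge> 0"
    and roots: "\<forall>s. Delta n \<tau> a \<alpha> s = 0 \<longrightarrow> r < norm (exp (- s * of_real \<tau>))"
  shows "\<exists>C > 0. \<forall>\<zeta> u B. norm \<zeta> \<le> r \<longrightarrow>
     (\<forall>k<n. \<forall>\<theta>\<in>{0..\<tau>}. (u k has_vector_derivative u (Suc k) \<theta>) (at \<theta> within {0..\<tau>})) \<longrightarrow>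
     (\<forall>\<theta>\<in>{0..\<tau>}. norm (u n \<theta> + (\<Sum>k<n. (of_real (a k) + \<zeta> * of_real (\<alpha> k)) * u k \<theta>)) \<le> B) \<longrightarrow>
     (\<forall>k<n. norm (u k 0 - \<zeta> * u k \<tau>) \<le> B) \<longrightarrow>
     (\<forall>k<n. \<forall>\<theta>\<in>{0..\<tau>}. norm (u k \<theta> :: complex) \<le> C * B)"
proof -
  define c where "c \<zeta> k = complex_of_real (a k) + \<zeta> * of_real (\<alpha> k)" for \<zeta> k
  \<comment> \<open>A bound on all characteristic roots, uniform over |\<zeta>| <= r.\<close>
  define L where "L = 1 + (\<Sum>k<n. \<bar>a k\<bar> + r * \<bar>\<alpha> k\<bar>)"
  have L: "L \<ge> 0" unfolding L_def using r by (intro add_nonneg_nonneg sum_nonneg) auto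
  have root_le: "norm l \<le> L" if "norm \<zeta> \<le> r" "l ^ n + (\<Sum>k<n. c \<zeta> k * l ^ k) = 0" for \<zeta> l
  proof -
    have "norm l \<le> 1 + (\<Sum>k<n. norm (c \<zeta> k))"
      using that(2) by (rule monic_root_bound)
    also have "\<dots> \<le> L"
      unfolding L_def c_def using that(1)
      by (intro add_left_mono sum_mono order.trans[OF norm_triangle_ineq] add_mono)
         (auto simp: norm_mult intro!: mult_right_mono)
    finally show ?thesis .
  qed
  define S where "S = {(\<zeta>, l). (\<zeta>, l) \<in> cball 0 r \<times> cball 0 L \<and> l ^ n + (\<Sum>k<n. c \<zeta> k * l ^ k) = 0}"
  have "S = (cball 0 r \<times> cball 0 L) \<inter> {x. snd x ^ n + (\<Sum>k<n. c (fst x) k * snd x ^ k) = 0}"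
    by (auto simp: S_def)
  moreover have "closed {x. snd x ^ n + (\<Sum>k<n. c (fst x) k * snd x ^ k) = (0::complex)}"
    unfolding c_def by (intro closed_Collect_eq continuous_intros)
  ultimately have "compact S"
    by (auto intro!: compact_Int_closed compact_Times)
  have pos: "1 - \<zeta> * exp (l * of_real \<tau>) \<noteq> 0" if "(\<zeta>, l) \<in> S" for \<zeta> l
  proof
    assume "1 - \<zeta> * exp (l * of_real \<tau>) = 0"
    then have \<zeta>: "\<zeta> = exp (- l * of_real \<tau>)" by (simp add: exp_minus field_simps)
    have "Delta n \<tau> a \<alpha> l = l ^ n + (\<Sum>k<n. c \<zeta> k * l ^ k)"
      by (simp add: Delta_def c_def \<zeta> sum_distrib_left sum.distrib algebra_simps)
    then show False using that roots \<zeta> by (auto simp: S_def)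
  qed
  \<comment> \<open>The boundary factor is continuous and nonzero on the compact set
    \<open>S\<close>, so its modulus has a positive minimum. If \<open>S\<close> is empty the
    requirement is vacuous and 1 serves.\<close>
  obtain \<delta> where \<delta>: "\<delta> > 0" "\<And>\<zeta> l. (\<zeta>, l) \<in> S \<Longrightarrow> \<delta> \<le> norm (1 - \<zeta> * exp (l * of_real \<tau>))"
  proof (cases "S = {}")
    case True then show ?thesis using that[of 1] by auto
  next
    case False
    have "continuous_on S (\<lambda>x. norm (1 - fst x * exp (snd x * of_real \<tau>)))"
      by (intro continuous_intros)
    from continuous_attains_inf[OF \<open>compact S\<close> False this] obtain x where
      x: "x \<in> S" "\<forall>y\<in>S. norm (1 - fst x * exp (snd x * of_real \<tau>)) \<le> norm (1 - fst y * exp (snd y * of_real \<tau>))"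
      by blast
    show ?thesis
      by (rule that[of "norm (1 - fst x * exp (snd x * of_real \<tau>))"])
         (use x pos[of "fst x" "snd x"] in auto)
  qed
  obtain C where C: "C \<ge> 0" and bound: "\<forall>p \<zeta> u B. degree p = n \<longrightarrow> lead_coeff p = 1 \<longrightarrow> norm \<zeta> \<le> r \<longrightarrow>
     (\<forall>l. poly p l = 0 \<longrightarrow> norm l \<le> L \<and> \<delta> \<le> norm (1 - \<zeta> * exp (l * of_real \<tau>))) \<longrightarrow>
     (\<forall>k<n. \<forall>\<theta>\<in>{0..\<tau>}. (u k has_vector_derivative u (Suc k) \<theta>) (at \<theta> within {0..\<tau>})) \<longrightarrow>
     (\<forall>\<theta>\<in>{0..\<tau>}. norm (\<Sum>k\<le>n. coeff p k * u k \<theta>) \<le> B) \<longrightarrow>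
     (\<forall>k<n. norm (u k 0 - \<zeta> * u k \<tau>) \<le> B) \<longrightarrow>
     (\<forall>k\<le>n. \<forall>\<theta>\<in>{0..\<tau>}. norm (u k \<theta> :: complex) \<le> C * B)"
    using twisted_ode_bound[OF \<tau> \<delta>(1) L r, of n]
    by (elim exE conjE) (rule that)
  \<comment> \<open>\<open>C + 1\<close> makes the constant strictly positive.\<close>
  show ?thesis
  proof (intro exI[of _ "C + 1"] conjI allI impI ballI)
    fix \<zeta> B k \<theta> and u :: "nat \<Rightarrow> real \<Rightarrow> complex"
    assume *: "norm \<zeta> \<le> r"
      "\<forall>k<n. \<forall>\<theta>\<in>{0..\<tau>}. (u k has_vector_derivative u (Suc k) \<theta>) (at \<theta> within {0..\<tau>})"
      "\<forall>\<theta>\<in>{0..\<tau>}. norm (u n \<theta> + (\<Sum>k<n. (of_real (a k) + \<zeta> * of_real (\<alpha> k)) * u k \<theta>)) \<le> B"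
      "\<forall>k<n. norm (u k 0 - \<zeta> * u k \<tau>) \<le> B" "k < n" "\<theta> \<in> {0..\<tau>}"
    define p where "p = monom 1 n + (\<Sum>k<n. monom (c \<zeta> k) k)"
    have coeff_p: "coeff p k = (if k = n then 1 else if k < n then c \<zeta> k else 0)" for k
      unfolding p_def by (simp add: coeff_sum sum.delta')
    have "degree p = n"
      by (rule antisym, rule degree_le) (auto simp: coeff_p intro!: le_degree)
    moreover from this have "lead_coeff p = 1" by (simp add: coeff_p)
    moreover have "poly p l = l ^ n + (\<Sum>k<n. c \<zeta> k * l ^ k)" for l
      unfolding p_def by (simp add: poly_sum poly_monom)
    then have "\<forall>l. poly p l = 0 \<longrightarrow> norm l \<le> L \<and> \<delta> \<le> norm (1 - \<zeta> * exp (l * of_real \<tau>))"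
      using root_le[OF *(1)] \<delta>(2) *(1) by (auto simp: S_def)
    moreover have "(\<Sum>k\<le>n. coeff p k * u k \<theta>) = u n \<theta> + (\<Sum>k<n. (of_real (a k) + \<zeta> * of_real (\<alpha> k)) * u k \<theta>)" for \<theta>
      unfolding lessThan_Suc_atMost[symmetric] by (simp add: coeff_p c_def)
    ultimately have "norm (u k \<theta>) \<le> C * B"
      using bound[rule_format, of p \<zeta> u B k \<theta>] * by auto
    moreover have "B \<ge> 0" using *(4,5) norm_ge_zero order.trans by blast
    ultimately show "norm (u k \<theta>) \<le> (C + 1) * B" by (simp add: distrib_right)
  qed (use C in auto)
qed

text \<open>Cauchy's inequality at 0 on the circle of radius \<open>R\<close>, applied to a
  polynomial.\<close>

lemma sum_power_coeff_bound:
  fixes b :: "nat \<Rightarrow> complex"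
  assumes R: "R > 0" and B: "\<And>\<zeta>. norm \<zeta> = R \<Longrightarrow> norm (\<Sum>i<N. b i * \<zeta> ^ i) \<le> B" and i: "i < N"
  shows "norm (b i) * R ^ i \<le> B"
proof -
  define p where "p = (\<Sum>i<N. monom (b i) i)"
  have poly: "poly p = (\<lambda>x. \<Sum>i<N. b i * x ^ i)" unfolding p_def by (rule ext) (simp add: poly_sum poly_monom)
  have coeff: "coeff p i = b i" using i unfolding p_def by (simp add: coeff_sum if_distrib cong: if_cong)
  have "(deriv ^^ i) (poly p) = poly ((pderiv ^^ i) p)"
    by (induction i) (auto intro!: ext DERIV_imp_deriv poly_DERIV)
  then have "(deriv ^^ i) (poly p) 0 = fact i * b i"
    by (simp add: poly_higher_pderiv_conv_coeff coeff pcompose_idR)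
  moreover have "norm ((deriv ^^ i) (poly p) 0) \<le> fact i * B / R ^ i"
    by (rule Cauchy_inequality) (use R B poly in \<open>auto intro!: holomorphic_intros continuous_intros\<close>)
  ultimately have "fact i * norm (b i) \<le> fact i * (B / R ^ i)"
    by (simp add: norm_mult)
  then have "norm (b i) \<le> B / R ^ i" by (subst (asm) mult_le_cancel_left_pos) auto
  then show ?thesis using R by (simp add: field_simps)
qed

subsection \<open>Exponential stability\<close>

text \<open>Summation by parts with Pascal's rule. What fails to telescope is a sum of the same kind
  with m - 1 in place of m, which opens the way to induction on m.\<close>

lemma binomial_sum_defect:
  fixes q :: "nat \<Rightarrow> complex"
  shows "(\<Sum>i<N. of_nat (i choose m) * \<zeta> ^ i * (\<zeta> * q (Suc i) - q i)) =
     of_nat (N choose m) * \<zeta> ^ N * q N - of_nat (0 choose m) * q 0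
      - \<zeta> * (if m = 0 then 0 else \<Sum>i<N. of_nat (i choose (m - 1)) * \<zeta> ^ i * q (Suc i))"
  by (induction N) (cases m; simp add: algebra_simps)+

text \<open>A single term of the binomial expansion gives (N choose m) t^m <= (1 + t)^N, and
  \<open>t\<close> is chosen so small that (1 + t) q < 1.\<close>

lemma choose_mult_power_tendsto_0:
  fixes q :: real
  assumes "0 \<le> q" "q < 1"
  shows "(\<lambda>N. real (N choose m) * q ^ N) \<longlonglongrightarrow> 0"
proof -
  define t where "t = (1 - q) / 2"
  have t: "t > 0" using assms by (simp add: t_def)
  have "(1 + t) * q < 1"
  proof -
    have "q * (1 - q) \<le> 1 * (1 - q)" using assms by (intro mult_right_mono) auto
    moreover have "(1 + t) * q = q + q * (1 - q) / 2" by (simp add: t_def field_simps)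
    ultimately have "(1 + t) * q \<le> q + (1 - q) / 2" by simp
    also have "\<dots> < 1" using assms by (simp add: field_simps)
    finally show ?thesis .
  qed
  then have "(\<lambda>N. ((1 + t) * q) ^ N * (1 / t ^ m)) \<longlonglongrightarrow> 0 * (1 / t ^ m)"
    using t assms by (intro tendsto_mult tendsto_const LIMSEQ_realpow_zero) auto
  then have lim: "(\<lambda>N. ((1 + t) * q) ^ N * (1 / t ^ m)) \<longlonglongrightarrow> 0" by simp
  have "real (N choose m) * q ^ N \<le> ((1 + t) * q) ^ N * (1 / t ^ m)" for N
  proof (cases "m \<le> N")
    case True
    have "real (N choose m) * t ^ m = real (N choose m) * t ^ m * 1 ^ (N - m)" by simp
    also have "\<dots> \<le> (\<Sum>k\<le>N. real (N choose k) * t ^ k * 1 ^ (N - k))"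
      using True t by (intro member_le_sum) auto
    also have "\<dots> = (t + 1) ^ N" by (simp only: binomial_ring)
    finally have "real (N choose m) * t ^ m * q ^ N \<le> (1 + t) ^ N * q ^ N"
      using assms by (intro mult_right_mono) (auto simp: add.commute)
    then show ?thesis unfolding power_mult_distrib using t by (simp add: pos_le_divide_eq mult_ac)
  next
    case False
    then show ?thesis using t assms by (simp add: binomial_eq_0)
  qed
  then show ?thesis
    using assms by (intro tendsto_sandwich[OF _ _ tendsto_const lim]) (auto intro!: always_eventually)
qed

text \<open>\<open>y j k\<close> is the \<open>k\<close>-th derivative of a solution on the \<open>j\<close>-th window
  \<open>[(j - 1) \<tau>, j \<tau>]\<close>, shifted to \<open>[0, \<tau>]\<close>; the window \<open>j = 0\<close> carries the initial data.\<close>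

locale delay_windows =
  fixes n :: nat and \<tau> r C \<Phi> :: real and a \<alpha> :: "nat \<Rightarrow> real"
    and y :: "nat \<Rightarrow> nat \<Rightarrow> real \<Rightarrow> complex"
  assumes n: "n > 0" and \<tau>: "\<tau> \<ge> 0" and C: "C > 0" and r: "r \<ge> 0"
    and twisted: "\<forall>\<zeta> u B. norm \<zeta> \<le> r \<longrightarrow>
     (\<forall>k<n. \<forall>\<theta>\<in>{0..\<tau>}. (u k has_vector_derivative u (Suc k) \<theta>) (at \<theta> within {0..\<tau>})) \<longrightarrow>
     (\<forall>\<theta>\<in>{0..\<tau>}. norm (u n \<theta> + (\<Sum>k<n. (of_real (a k) + \<zeta> * of_real (\<alpha> k)) * u k \<theta>)) \<le> B) \<longrightarrow>
     (\<forall>k<n. norm (u k 0 - \<zeta> * u k \<tau>) \<le> B) \<longrightarrow>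
     (\<forall>k<n. \<forall>\<theta>\<in>{0..\<tau>}. norm (u k \<theta> :: complex) \<le> C * B)"
    and deriv: "k < n \<Longrightarrow> \<theta> \<in> {0..\<tau>} \<Longrightarrow> (y j k has_vector_derivative y j (Suc k) \<theta>) (at \<theta> within {0..\<tau>})"
    and ode: "\<theta> \<in> {0..\<tau>} \<Longrightarrow>
      y (Suc j) n \<theta> + (\<Sum>k<n. of_real (a k) * y (Suc j) k \<theta>) + (\<Sum>k<n. of_real (\<alpha> k) * y j k \<theta>) = 0"
    and glue: "k < n \<Longrightarrow> y (Suc j) k 0 = y j k \<tau>"
    and init: "k < n \<Longrightarrow> \<theta> \<in> {0..\<tau>} \<Longrightarrow> norm (y 0 k \<theta>) \<le> \<Phi>"
begin

text \<open>The summand 1 lets \<open>A\<close> also dominate the boundary defect. \<open>D\<close>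
  is the cost of one solution of the twisted problem.\<close>

definition A where "A = 1 + (\<Sum>k<n. \<bar>\<alpha> k\<bar>)"
definition D where "D = C * A"

text \<open>\<zeta>^m / m! times the m-th \<zeta>-derivative of the truncated generating function of
  the windows 1 to N. This normalisation avoids negative powers of \<zeta>.\<close>

definition gen :: "nat \<Rightarrow> nat \<Rightarrow> complex \<Rightarrow> nat \<Rightarrow> real \<Rightarrow> complex" where
  "gen N m \<zeta> k \<theta> = (\<Sum>i<N. of_nat (i choose m) * \<zeta> ^ i * y (Suc i) k \<theta>)"

lemma A_ge_1: "A \<ge> 1" unfolding A_def by (simp add: sum_nonneg)

lemma D_pos: "D > 0" unfolding D_def using A_ge_1 C by simp

lemma Phi_nonneg: "\<Phi> \<ge> 0"
  using order.trans[OF norm_ge_zero init[of 0 0]] n \<tau> by simp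

lemma sum_delay_bound:
  assumes "\<And>k. k < n \<Longrightarrow> norm (w k) \<le> B" "B \<ge> 0"
  shows "norm (\<Sum>k<n. complex_of_real (\<alpha> k) * w k) \<le> A * B"
proof -
  have "norm (\<Sum>k<n. complex_of_real (\<alpha> k) * w k) \<le> (\<Sum>k<n. \<bar>\<alpha> k\<bar> * B)"
    using assms by (intro order.trans[OF norm_sum] sum_mono) (auto simp: norm_mult intro!: mult_left_mono)
  also have "\<dots> \<le> A * B"
    using assms(2) by (simp add: A_def distrib_right sum_distrib_right)
  finally show ?thesis .
qed

text \<open>Replacing the delayed window y_i by \<zeta> y_(i+1) turns the delay equation into the
  twisted problem for \<open>gen\<close>. The error telescopes into the initial data (only for m =
  0), a truncation term at index N, and \<open>gen\<close> of order m - 1.\<close>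

lemma gen_step:
  assumes \<zeta>: "norm \<zeta> \<le> R" "R \<le> r"
    and f: "\<And>k \<theta>. k < n \<Longrightarrow> \<theta> \<in> {0..\<tau>} \<Longrightarrow> norm (y N k \<theta>) \<le> f"
    and e: "\<And>k \<theta>. k < n \<Longrightarrow> \<theta> \<in> {0..\<tau>} \<Longrightarrow> norm (if m = 0 then 0 else gen N (m - 1) \<zeta> k \<theta>) \<le> e"
    and k: "k < n" "\<theta> \<in> {0..\<tau>}"
  shows "norm (gen N m \<zeta> k \<theta>) \<le> D * (real (0 choose m) * \<Phi> + real (N choose m) * R ^ N * f + R * e)"
proof -
  define B where "B = real (0 choose m) * \<Phi> + real (N choose m) * R ^ N * f + R * e"
  have f0: "f \<ge> 0" and e0: "e \<ge> 0"
    using f[OF k] e[OF k] norm_ge_zero order.trans by blast+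
  have R: "R \<ge> 0" using \<zeta>(1) norm_ge_zero order.trans by blast
  have B0: "B \<ge> 0" unfolding B_def using f0 e0 Phi_nonneg R by simp
  \<comment> \<open>The same defect enters twice: weighted by the \<alpha> k in the equation and, by
    gluing of adjacent windows, as -T(\<tau>) in the boundary condition.\<close>
  define T where "T k \<theta> = (\<Sum>i<N. of_nat (i choose m) * \<zeta> ^ i * (\<zeta> * y (Suc i) k \<theta> - y i k \<theta>))" for k \<theta>
  have T: "norm (T k \<theta>) \<le> B" if "k < n" "\<theta> \<in> {0..\<tau>}" for k \<theta>
  proof -
    have "T k \<theta> = of_nat (N choose m) * \<zeta> ^ N * y N k \<theta> - of_nat (0 choose m) * y 0 k \<theta>
            - \<zeta> * (if m = 0 then 0 else gen N (m - 1) \<zeta> k \<theta>)"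
      unfolding T_def gen_def by (rule binomial_sum_defect)
    also have "norm \<dots> \<le> real (N choose m) * R ^ N * f + real (0 choose m) * \<Phi> + R * e"
    proof (intro order.trans[OF norm_triangle_ineq4 add_mono] order.trans[OF norm_triangle_ineq4 add_mono])
      show "norm (of_nat (N choose m) * \<zeta> ^ N * y N k \<theta>) \<le> real (N choose m) * R ^ N * f"
        unfolding norm_mult norm_power using f[OF that] \<zeta>(1) R f0
        by (intro mult_mono mult_left_mono power_mono) auto
      show "norm (of_nat (0 choose m) * y 0 k \<theta>) \<le> real (0 choose m) * \<Phi>"
        unfolding norm_mult using init[OF that] by (intro mult_mono) auto
      show "norm (\<zeta> * (if m = 0 then 0 else gen N (m - 1) \<zeta> k \<theta>)) \<le> R * e"
        unfolding norm_mult using e[OF that] \<zeta>(1) R by (intro mult_mono) auto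
    qed
    finally show ?thesis by (simp add: B_def)
  qed
  have "norm (gen N m \<zeta> k \<theta>) \<le> C * (A * B)"
  proof (rule twisted[rule_format, of \<zeta> "gen N m \<zeta>"])
    show "norm \<zeta> \<le> r" using \<zeta> by simp
    show "(gen N m \<zeta> k has_vector_derivative gen N m \<zeta> (Suc k) \<theta>) (at \<theta> within {0..\<tau>})"
      if "k < n" "\<theta> \<in> {0..\<tau>}" for k \<theta>
      unfolding gen_def[abs_def]
      by (intro has_vector_derivative_sum has_vector_derivative_mult_right deriv that)
    show "norm (gen N m \<zeta> n \<theta> + (\<Sum>k<n. (of_real (a k) + \<zeta> * of_real (\<alpha> k)) * gen N m \<zeta> k \<theta>)) \<le> A * B"
      if \<theta>: "\<theta> \<in> {0..\<tau>}" for \<theta>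
    proof -
      have swap: "(\<Sum>k<n. g k * gen N m \<zeta> k \<theta>) = (\<Sum>i<N. of_nat (i choose m) * \<zeta> ^ i * (\<Sum>k<n. g k * y (Suc i) k \<theta>))" for g
        unfolding gen_def sum_distrib_left by (subst sum.swap) (simp add: mult_ac)
      have "gen N m \<zeta> n \<theta> + (\<Sum>k<n. (of_real (a k) + \<zeta> * of_real (\<alpha> k)) * gen N m \<zeta> k \<theta>)
         = (\<Sum>i<N. of_nat (i choose m) * \<zeta> ^ i *
             (y (Suc i) n \<theta> + (\<Sum>k<n. (of_real (a k) + \<zeta> * of_real (\<alpha> k)) * y (Suc i) k \<theta>)))"
        unfolding swap by (simp add: gen_def distrib_left sum.distrib)
      also have "\<dots> = (\<Sum>i<N. of_nat (i choose m) * \<zeta> ^ i * (\<Sum>k<n. of_real (\<alpha> k) * (\<zeta> * y (Suc i) k \<theta> - y i k \<theta>)))"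
      proof (intro sum.cong refl arg_cong2[of _ _ _ _ "(*)"])
        fix i
        have 1: "(\<Sum>k<n. of_real (\<alpha> k) * (\<zeta> * y (Suc i) k \<theta> - y i k \<theta>))
           = \<zeta> * (\<Sum>k<n. of_real (\<alpha> k) * y (Suc i) k \<theta>) - (\<Sum>k<n. of_real (\<alpha> k) * y i k \<theta>)"
          by (simp add: right_diff_distrib sum_subtractf sum_distrib_left mult_ac)
        have 2: "(\<Sum>k<n. (of_real (a k) + \<zeta> * of_real (\<alpha> k)) * y (Suc i) k \<theta>)
           = (\<Sum>k<n. of_real (a k) * y (Suc i) k \<theta>) + \<zeta> * (\<Sum>k<n. of_real (\<alpha> k) * y (Suc i) k \<theta>)"
          by (simp add: algebra_simps sum.distrib sum_distrib_left)
        have 3: "p + q + w = 0 \<Longrightarrow> p + (q + x) = x - w" for p q w x :: complex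
          by algebra
        show "y (Suc i) n \<theta> + (\<Sum>k<n. (of_real (a k) + \<zeta> * of_real (\<alpha> k)) * y (Suc i) k \<theta>)
           = (\<Sum>k<n. of_real (\<alpha> k) * (\<zeta> * y (Suc i) k \<theta> - y i k \<theta>))"
          unfolding 1 2 by (rule 3[OF ode[OF \<theta>]])
      qed
      also have "\<dots> = (\<Sum>k<n. of_real (\<alpha> k) * T k \<theta>)"
        unfolding T_def sum_distrib_left by (subst sum.swap) (simp add: mult_ac)
      also have "norm \<dots> \<le> A * B"
        using T \<theta> B0 by (intro sum_delay_bound) auto
      finally show ?thesis .
    qed
    show "norm (gen N m \<zeta> k 0 - \<zeta> * gen N m \<zeta> k \<tau>) \<le> A * B" if "k < n" for k
    proof -
      have "gen N m \<zeta> k 0 - \<zeta> * gen N m \<zeta> k \<tau> = - T k \<tau>"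
        unfolding gen_def T_def
        by (simp add: glue[OF that] sum_distrib_left sum_subtractf right_diff_distrib mult_ac)
      moreover have "1 * B \<le> A * B" using A_ge_1 B0 by (intro mult_right_mono) auto
      ultimately show ?thesis using T[OF that, of \<tau>] \<tau> by simp
    qed
  qed (use k in auto)
  then show ?thesis by (simp add: D_def B_def mult.assoc)
qed

text \<open>Each increase of m costs a factor D R. The truncation terms vanish only as N grows, so
  the clean constant appears as the limit of the bounds \<open>E\<close>.\<close>

lemma gen_bound_limit:
  assumes R: "0 \<le> R" "R \<le> r"
    and f: "\<And>N k \<theta>. k < n \<Longrightarrow> \<theta> \<in> {0..\<tau>} \<Longrightarrow> norm (y N k \<theta>) \<le> f N"
    and lim: "\<And>m. (\<lambda>N. real (N choose m) * R ^ N * f N) \<longlonglongrightarrow> 0"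
  shows "\<exists>E. E \<longlonglongrightarrow> D * (D * R) ^ m * \<Phi> \<and>
     (\<forall>N \<zeta> k \<theta>. norm \<zeta> \<le> R \<longrightarrow> k < n \<longrightarrow> \<theta> \<in> {0..\<tau>} \<longrightarrow> norm (gen N m \<zeta> k \<theta>) \<le> E N)"
proof (induction m)
  case 0
  let ?E = "\<lambda>N. D * (\<Phi> + real (N choose 0) * R ^ N * f N)"
  have "?E \<longlonglongrightarrow> D * (\<Phi> + 0)"
    by (intro tendsto_intros lim)
  moreover have "norm (gen N 0 \<zeta> k \<theta>) \<le> ?E N" if "norm \<zeta> \<le> R" "k < n" "\<theta> \<in> {0..\<tau>}" for N \<zeta> k \<theta>
    using gen_step[where m = 0 and e = 0 and f = "f N", OF that(1) R(2) _ _ that(2,3)] f by simp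
  ultimately show ?case by (intro exI[of _ ?E]) auto
next
  case (Suc m)
  then obtain E where E: "E \<longlonglongrightarrow> D * (D * R) ^ m * \<Phi>"
    "\<And>N \<zeta> k \<theta>. norm \<zeta> \<le> R \<Longrightarrow> k < n \<Longrightarrow> \<theta> \<in> {0..\<tau>} \<Longrightarrow> norm (gen N m \<zeta> k \<theta>) \<le> E N"
    by blast
  let ?E = "\<lambda>N. D * (real (N choose Suc m) * R ^ N * f N + R * E N)"
  have "?E \<longlonglongrightarrow> D * (0 + R * (D * (D * R) ^ m * \<Phi>))"
    by (intro tendsto_intros lim E(1))
  moreover have "norm (gen N (Suc m) \<zeta> k \<theta>) \<le> ?E N" if "norm \<zeta> \<le> R" "k < n" "\<theta> \<in> {0..\<tau>}" for N \<zeta> k \<theta>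
    using gen_step[where m = "Suc m" and e = "E N" and f = "f N", OF that(1) R(2) _ _ that(2,3)] f E(2)[OF that(1)]
    by simp
  ultimately show ?case by (intro exI[of _ ?E]) (auto simp: mult_ac)
qed

text \<open>Cauchy's inequality on |\<zeta>| = R for every N > i, followed by N to infinity.\<close>

lemma coeff_bound:
  assumes R: "0 < R" "R \<le> r"
    and f: "\<And>N k \<theta>. k < n \<Longrightarrow> \<theta> \<in> {0..\<tau>} \<Longrightarrow> norm (y N k \<theta>) \<le> f N"
    and lim: "\<And>m. (\<lambda>N. real (N choose m) * R ^ N * f N) \<longlonglongrightarrow> 0"
    and k: "k < n" "\<theta> \<in> {0..\<tau>}"
  shows "real (i choose m) * norm (y (Suc i) k \<theta>) * R ^ i \<le> D * (D * R) ^ m * \<Phi>"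
proof -
  obtain E where E: "E \<longlonglongrightarrow> D * (D * R) ^ m * \<Phi>"
    "\<And>N \<zeta> k \<theta>. norm \<zeta> \<le> R \<Longrightarrow> k < n \<Longrightarrow> \<theta> \<in> {0..\<tau>} \<Longrightarrow> norm (gen N m \<zeta> k \<theta>) \<le> E N"
    using gen_bound_limit[OF less_imp_le[OF R(1)] R(2) f lim, of m] by blast
  have "real (i choose m) * norm (y (Suc i) k \<theta>) * R ^ i \<le> E N" if "N \<ge> Suc i" for N
  proof -
    have "norm (of_nat (i choose m) * y (Suc i) k \<theta>) * R ^ i \<le> E N"
    proof (rule sum_power_coeff_bound[where N = N and b = "\<lambda>i. of_nat (i choose m) * y (Suc i) k \<theta>", OF R(1)])
      show "norm (\<Sum>i<N. of_nat (i choose m) * y (Suc i) k \<theta> * \<zeta> ^ i) \<le> E N" if "norm \<zeta> = R" for \<zeta>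
        using E(2)[of \<zeta> k \<theta> N] that k by (simp add: gen_def mult_ac)
    qed (use that in auto)
    then show ?thesis by (simp add: norm_mult)
  qed
  then show ?thesis by (intro LIMSEQ_le_const[OF E(1)]) blast
qed

text \<open>Summing the Taylor coefficient bounds against \<open>(1 / (2 D R)) ^ m\<close> amounts to evaluating the
  Taylor expansion at radius \<open>R + 1 / (2 D)\<close>: the radius of convergence exceeds \<open>R\<close> by a
  fixed amount.\<close>

lemma radius_gain:
  assumes R: "0 < R" "R \<le> r"
    and f: "\<And>N k \<theta>. k < n \<Longrightarrow> \<theta> \<in> {0..\<tau>} \<Longrightarrow> norm (y N k \<theta>) \<le> f N"
    and lim: "\<And>m. (\<lambda>N. real (N choose m) * R ^ N * f N) \<longlonglongrightarrow> 0"
    and k: "k < n" "\<theta> \<in> {0..\<tau>}"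
  shows "norm (y (Suc i) k \<theta>) * (R + 1 / (2 * D)) ^ i \<le> 2 * D * \<Phi>"
proof -
  \<comment> \<open>Chosen so that R (1 + t) = R + 1 / (2D) and D R t = 1/2; the sum over m becomes
    geometric with value below 2.\<close>
  define t where "t = 1 / (2 * D * R)"
  have t: "t > 0" unfolding t_def using D_pos R by simp
  have "R + 1 / (2 * D) = R * (t + 1)" using D_pos R by (simp add: t_def field_simps)
  then have "norm (y (Suc i) k \<theta>) * (R + 1 / (2 * D)) ^ i = norm (y (Suc i) k \<theta>) * R ^ i * (t + 1) ^ i"
    by (simp add: power_mult_distrib)
  also have "\<dots> = (\<Sum>m\<le>i. (real (i choose m) * norm (y (Suc i) k \<theta>) * R ^ i) * t ^ m)"
    unfolding binomial_ring sum_distrib_left by (simp add: mult_ac)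
  also have "\<dots> \<le> (\<Sum>m\<le>i. (D * (D * R) ^ m * \<Phi>) * t ^ m)"
    using t by (intro sum_mono mult_right_mono coeff_bound[OF R f lim k]) auto
  also have "\<dots> = D * \<Phi> * (\<Sum>m\<le>i. (1 / 2) ^ m)"
  proof -
    have "(D * R) ^ m * t ^ m = (1 / 2) ^ m" for m
      using D_pos R by (simp add: t_def flip: power_mult_distrib)
    moreover have "(D * (D * R) ^ m * \<Phi>) * t ^ m = D * \<Phi> * ((D * R) ^ m * t ^ m)" for m
      by (simp only: mult_ac)
    ultimately show ?thesis by (simp only: sum_distrib_left)
  qed
  also have "\<dots> \<le> D * \<Phi> * 2"
  proof (intro mult_left_mono)
    have "(\<Sum>m\<le>i. (1 / 2) ^ m) = (2::real) - (1 / 2) ^ i" by (induction i) auto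
    then show "(\<Sum>m\<le>i. (1 / 2) ^ m) \<le> (2::real)" by simp
  qed (use D_pos Phi_nonneg in auto)
  finally show ?thesis by (simp add: mult_ac)
qed

text \<open>The constant on the right does not depend on \<open>\<rho>\<close>, so enlarging the
  radius can be iterated without loss.\<close>

definition radius where
  "radius \<rho> \<longleftrightarrow> (\<forall>i k \<theta>. k < n \<longrightarrow> \<theta> \<in> {0..\<tau>} \<longrightarrow> norm (y (Suc i) k \<theta>) * \<rho> ^ i \<le> 2 * D * \<Phi>)"

text \<open>Retreating by 1 / (4D) makes the bound at \<open>\<rho>\<close> geometric with ratio R /
  \<rho> < 1, so the truncation terms vanish. The subsequent gain of 1 / (2D) leaves a net advance
  of 1 / (4D).\<close>

lemma radius_step:
  assumes \<rho>: "radius \<rho>" "1 / (4 * D) < \<rho>" "\<rho> - 1 / (4 * D) \<le> r"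
  shows "radius (\<rho> + 1 / (4 * D))"
proof -
  define R where "R = \<rho> - 1 / (4 * D)"
  have R: "0 < R" "R \<le> r" "R < \<rho>" unfolding R_def using \<rho> D_pos by auto
  have \<rho>0: "\<rho> > 0" using R by simp
  \<comment> \<open>\<open>\<Phi>\<close> covers the initial window N = 0, the other summand the
    windows N = i + 1; its factor \<open>\<rho>\<close> makes up for the index shift.\<close>
  define K where "K = \<Phi> + 2 * D * \<Phi> * \<rho>"
  define f where "f N = K * (1 / \<rho>) ^ N" for N
  have f: "norm (y N k \<theta>) \<le> f N" if "k < n" "\<theta> \<in> {0..\<tau>}" for N k \<theta>
  proof (cases N)
    case 0
    have "0 \<le> 2 * D * \<Phi> * \<rho>" using D_pos Phi_nonneg \<rho>0 by simp
    then have "norm (y 0 k \<theta>) \<le> K" unfolding K_def using init[OF that] by linarith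
    then show ?thesis using 0 by (simp add: f_def)
  next
    case (Suc i)
    have "norm (y (Suc i) k \<theta>) * \<rho> ^ i \<le> 2 * D * \<Phi>"
      using \<rho>(1) that unfolding radius_def by blast
    then have "norm (y (Suc i) k \<theta>) \<le> 2 * D * \<Phi> / \<rho> ^ i"
      using \<rho>0 by (simp add: field_simps)
    also have "\<dots> = 2 * D * \<Phi> * \<rho> * (1 / \<rho>) ^ N"
      using \<rho>0 Suc by (simp add: field_simps)
    also have "\<dots> \<le> f N"
      unfolding f_def K_def using Phi_nonneg \<rho>0 by (intro mult_right_mono) auto
    finally show ?thesis using Suc by simp
  qed
  have lim: "(\<lambda>N. real (N choose m) * R ^ N * f N) \<longlonglongrightarrow> 0" for m
  proof -
    have "(\<lambda>N. K * (real (N choose m) * (R / \<rho>) ^ N)) \<longlonglongrightarrow> K * 0"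
      using R \<rho>0 by (intro tendsto_intros choose_mult_power_tendsto_0) auto
    moreover have "real (N choose m) * R ^ N * f N = K * (real (N choose m) * (R / \<rho>) ^ N)" for N
      by (simp add: f_def power_divide)
    ultimately show ?thesis by (simp only: mult_zero_right)
  qed
  have "R + 1 / (2 * D) = \<rho> + 1 / (4 * D)" using D_pos by (simp add: R_def field_simps)
  then show ?thesis
    unfolding radius_def using radius_gain[OF R(1,2) f lim] by simp
qed

text \<open>For \<zeta> = 0 the twisted problem is the initial value problem on one window, so sizes
  grow by at most a factor \<open>D\<close> per window.\<close>

lemma radius_start: "radius (1 / D)"
proof -
  have bound: "\<forall>k \<theta>. k < n \<longrightarrow> \<theta> \<in> {0..\<tau>} \<longrightarrow> norm (y j k \<theta>) \<le> D ^ j * \<Phi>" for j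
  proof (induction j)
    case 0 then show ?case using init by simp
  next
    case (Suc j)
    have pos: "D ^ j * \<Phi> \<ge> 0" using D_pos Phi_nonneg by simp
    have "norm (y (Suc j) k \<theta>) \<le> C * (A * (D ^ j * \<Phi>))" if "k < n" "\<theta> \<in> {0..\<tau>}" for k \<theta>
    proof (rule twisted[rule_format, of 0 "y (Suc j)"])
      show "norm (y (Suc j) n \<theta> + (\<Sum>k<n. (of_real (a k) + 0 * of_real (\<alpha> k)) * y (Suc j) k \<theta>)) \<le> A * (D ^ j * \<Phi>)"
        if "\<theta> \<in> {0..\<tau>}" for \<theta>
      proof -
        have "y (Suc j) n \<theta> + (\<Sum>k<n. (of_real (a k) + 0 * of_real (\<alpha> k)) * y (Suc j) k \<theta>)
           = - (\<Sum>k<n. of_real (\<alpha> k) * y j k \<theta>)"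
          using ode[OF that, of j] by (simp add: eq_neg_iff_add_eq_0)
        then show ?thesis
          using Suc pos that by (simp only: norm_minus_cancel) (intro sum_delay_bound, auto)
      qed
      show "norm (y (Suc j) k 0 - 0 * y (Suc j) k \<tau>) \<le> A * (D ^ j * \<Phi>)" if "k < n" for k
      proof -
        have "1 * (D ^ j * \<Phi>) \<le> A * (D ^ j * \<Phi>)" using A_ge_1 pos by (intro mult_right_mono) auto
        moreover have "norm (y j k \<tau>) \<le> D ^ j * \<Phi>" using Suc that \<tau> by simp
        ultimately show ?thesis using glue[OF that] by simp
      qed
    qed (use that r deriv in auto)
    then show ?case by (simp add: D_def mult_ac)
  qed
  show ?thesis
    unfolding radius_def
  proof (intro allI impI)
    fix i k \<theta> assume *: "k < n" "\<theta> \<in> {0..\<tau>}"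
    have "norm (y (Suc i) k \<theta>) * (1 / D) ^ i \<le> D ^ Suc i * \<Phi> * (1 / D) ^ i"
      using bound[of "Suc i", rule_format, OF *] D_pos by (intro mult_right_mono) auto
    also have "\<dots> = D * \<Phi>" using D_pos by (simp add: power_divide)
    also have "\<dots> \<le> 2 * D * \<Phi>" using D_pos Phi_nonneg by simp
    finally show "norm (y (Suc i) k \<theta>) * (1 / D) ^ i \<le> 2 * D * \<Phi>" .
  qed
qed

text \<open>Advancing the radius by the fixed amount 1 / (4D) reaches \<open>r\<close> after
  finitely many steps.\<close>

lemma window_decay:
  assumes k: "k < n" "\<theta> \<in> {0..\<tau>}"
  shows "norm (y (Suc i) k \<theta>) * r ^ i \<le> 2 * D * \<Phi>"
proof -
  \<comment> \<open>Keeping \<open>\<rho>\<close> at least 1 / D leaves room for the retreat in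
    \<open>radius_step\<close>; once \<open>r\<close> is reached the iteration may stop.\<close>
  have "\<exists>\<rho> \<ge> 1 / D. radius \<rho> \<and> (\<rho> \<ge> r \<or> \<rho> \<ge> real s * (1 / (4 * D)))" for s
  proof (induction s)
    case 0
    show ?case using radius_start D_pos by (intro exI[of _ "1 / D"]) auto
  next
    case (Suc s)
    then obtain \<rho> where \<rho>: "\<rho> \<ge> 1 / D" "radius \<rho>" "\<rho> \<ge> r \<or> \<rho> \<ge> real s * (1 / (4 * D))" by blast
    have x: "1 / (4 * D) > 0" "1 / (4 * D) < 1 / D" using D_pos by (auto simp: field_simps)
    show ?case
    proof (cases "\<rho> \<ge> r")
      case False
      then have "radius (\<rho> + 1 / (4 * D))" using \<rho> x by (intro radius_step) auto
      then show ?thesis using \<rho> x False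
        by (intro exI[of _ "\<rho> + 1 / (4 * D)"]) (auto simp: distrib_right add_divide_distrib)
    qed (use \<rho> in blast)
  qed
  moreover have "0 < 1 / (4 * D)" using D_pos by simp
  then obtain s where "r < real s * (1 / (4 * D))"
    using reals_Archimedean3 by blast
  then have "r \<le> real s * (1 / (4 * D))" by simp
  ultimately obtain \<rho> where \<rho>: "radius \<rho>" "\<rho> \<ge> r" by (meson order.trans)
  have "norm (y (Suc i) k \<theta>) * r ^ i \<le> norm (y (Suc i) k \<theta>) * \<rho> ^ i"
    using \<rho> r by (intro mult_left_mono power_mono) auto
  also have "\<dots> \<le> 2 * D * \<Phi>" using \<rho>(1) k unfolding radius_def by blast
  finally show ?thesis .
qed

end

section \<open>From the window estimates to stability of the delay equation\<close>

lemma init_norm_ge: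
  assumes sol: "dde_solution n \<tau> a \<alpha> Y" and k: "k < n" "\<theta> \<in> {- \<tau>..0}"
  shows "\<bar>Y k \<theta>\<bar> \<le> init_norm n \<tau> Y"
  unfolding init_norm_def
proof (rule cSup_upper)
  have "bounded ((\<lambda>\<theta>. \<bar>Y k \<theta>\<bar>) ` {- \<tau>..0})" if "k < n" for k
  proof (intro compact_imp_bounded compact_continuous_image continuous_intros)
    show "continuous_on {- \<tau>..0} (Y k)"
    proof (rule DERIV_continuous_on)
      fix t assume "t \<in> {- \<tau>..0}"
      then have "(Y k has_real_derivative Y (Suc k) t) (at t within {- \<tau>..})"
        using sol that unfolding dde_solution_def by auto
      then show "(Y k has_real_derivative Y (Suc k) t) (at t within {- \<tau>..0})"
        by (rule DERIV_subset) auto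
    qed
  qed auto
  \<comment> \<open>A finite union of continuous images of a compact interval is bounded, so the
    supremum dominates its members.\<close>
  then have "bdd_above (\<Union>k\<in>{..<n}. (\<lambda>\<theta>. \<bar>Y k \<theta>\<bar>) ` {- \<tau>..0})"
    by (auto intro: bounded_imp_bdd_above)
  moreover have "{\<bar>Y k \<theta>\<bar> |k \<theta>. k < n \<and> \<theta> \<in> {- \<tau>..0}} = (\<Union>k\<in>{..<n}. (\<lambda>\<theta>. \<bar>Y k \<theta>\<bar>) ` {- \<tau>..0})"
    by auto blast
  ultimately show "bdd_above {\<bar>Y k \<theta>\<bar> |k \<theta>. k < n \<and> \<theta> \<in> {- \<tau>..0}}" by simp
qed (use k in blast)

text \<open>Taking half of the spectral gap as the rate \<open>\<gamma>\<close> keeps every |exp (-s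
  \<tau>)| strictly above r = exp (\<gamma> \<tau>), as the twisted bound requires; decay like
  r^(-i) per window is decay at rate \<open>\<gamma>\<close> in time.\<close>

lemma exp_stable_if_roots_left:
  assumes n: "n > 0" and \<tau>: "\<tau> > 0" and s0: "s0 < 0"
    and roots: "\<And>s. Delta n \<tau> a \<alpha> s = 0 \<Longrightarrow> Re s \<le> s0"
  shows "exp_stable n \<tau> a \<alpha>"
proof -
  define \<gamma> where "\<gamma> = - s0 / 2"
  define r where "r = exp (\<gamma> * \<tau>)"
  have \<gamma>: "\<gamma> > 0" using s0 by (simp add: \<gamma>_def)
  have r: "r > 0" by (simp add: r_def)
  have "\<forall>s. Delta n \<tau> a \<alpha> s = 0 \<longrightarrow> r < norm (exp (- s * of_real \<tau>))"
  proof (intro allI impI)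
    fix s assume s: "Delta n \<tau> a \<alpha> s = 0"
    have "\<gamma> * \<tau> < - Re s * \<tau>"
      using roots[OF s] s0 \<tau> by (intro mult_strict_right_mono) (auto simp: \<gamma>_def)
    then show "r < norm (exp (- s * of_real \<tau>))" by (simp add: r_def)
  qed
  from delay_twisted_bound[OF \<tau> less_imp_le[OF r] this]
  obtain C where C: "C > 0" and twisted: "\<forall>\<zeta> u B. norm \<zeta> \<le> r \<longrightarrow>
     (\<forall>k<n. \<forall>\<theta>\<in>{0..\<tau>}. (u k has_vector_derivative u (Suc k) \<theta>) (at \<theta> within {0..\<tau>})) \<longrightarrow>
     (\<forall>\<theta>\<in>{0..\<tau>}. norm (u n \<theta> + (\<Sum>k<n. (of_real (a k) + \<zeta> * of_real (\<alpha> k)) * u k \<theta>)) \<le> B) \<longrightarrow>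
     (\<forall>k<n. norm (u k 0 - \<zeta> * u k \<tau>) \<le> B) \<longrightarrow>
     (\<forall>k<n. \<forall>\<theta>\<in>{0..\<tau>}. norm (u k \<theta> :: complex) \<le> C * B)"
    by (elim exE conjE) (rule that)
  define K where "K = C * (1 + (\<Sum>k<n. \<bar>\<alpha> k\<bar>))"
  have "K > 0" unfolding K_def using C by (intro mult_pos_pos add_pos_nonneg sum_nonneg) auto
  have decay: "\<bar>Y 0 t\<bar> \<le> (2 * K * r) * exp (- \<gamma> * t) * init_norm n \<tau> Y"
    if sol: "dde_solution n \<tau> a \<alpha> Y" and t: "t \<ge> 0" for Y t
  proof -
    \<comment> \<open>The offset j - 1 makes window 0 the initial interval [-\<tau>, 0].\<close>
    define sh where "sh j = (real j - 1) * \<tau>" for j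
    define y where "y j k \<theta> = complex_of_real (Y k (\<theta> + sh j))" for j k \<theta>
    have sh: "\<theta> + sh j \<ge> - \<tau>" if "\<theta> \<ge> 0" for \<theta> j
      using that \<tau> by (simp add: sh_def algebra_simps)
    have sh_Suc: "sh (Suc j) = sh j + \<tau>" for j by (simp add: sh_def algebra_simps)
    interpret w: delay_windows n \<tau> r C "init_norm n \<tau> Y" a \<alpha> y
    proof
      show "(y j k has_vector_derivative y j (Suc k) \<theta>) (at \<theta> within {0..\<tau>})"
        if "k < n" "\<theta> \<in> {0..\<tau>}" for j k \<theta>
      proof -
        have "(Y k has_real_derivative Y (Suc k) (\<theta> + sh j)) (at (\<theta> + sh j) within {- \<tau>..})"
          using sol that sh[of \<theta> j] unfolding dde_solution_def by auto
        then have "(Y k has_real_derivative Y (Suc k) (\<theta> + sh j)) (at (\<theta> + sh j) within (\<lambda>\<theta>. \<theta> + sh j) ` {0..\<tau>})"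
          by (rule DERIV_subset) (use sh[of 0 j] in auto)
        moreover have "((\<lambda>\<theta>. \<theta> + sh j) has_real_derivative 1) (at \<theta> within {0..\<tau>})"
          by (auto intro!: derivative_eq_intros)
        ultimately have "((Y k \<circ> (\<lambda>\<theta>. \<theta> + sh j)) has_real_derivative Y (Suc k) (\<theta> + sh j) * 1) (at \<theta> within {0..\<tau>})"
          by (rule DERIV_image_chain)
        then have "((\<lambda>\<theta>. Y k (\<theta> + sh j)) has_vector_derivative Y (Suc k) (\<theta> + sh j)) (at \<theta> within {0..\<tau>})"
          by (simp add: o_def has_real_derivative_iff_has_vector_derivative)
        then show ?thesis
          unfolding y_def by (rule bounded_linear.has_vector_derivative[OF bounded_linear_of_real])
      qed
      show "y (Suc j) n \<theta> + (\<Sum>k<n. of_real (a k) * y (Suc j) k \<theta>) + (\<Sum>k<n. of_real (\<alpha> k) * y j k \<theta>) = 0"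
        if "\<theta> \<in> {0..\<tau>}" for j \<theta>
      proof -
        define t where "t = \<theta> + sh (Suc j)"
        have "t \<ge> 0" "t - \<tau> = \<theta> + sh j"
          using that \<tau> by (auto simp: t_def sh_def algebra_simps)
        then have "Y n t + (\<Sum>k<n. a k * Y k t) + (\<Sum>k<n. \<alpha> k * Y k (\<theta> + sh j)) = 0"
          using sol unfolding dde_solution_def by metis
        then have "complex_of_real (Y n t + (\<Sum>k<n. a k * Y k t) + (\<Sum>k<n. \<alpha> k * Y k (\<theta> + sh j))) = 0"
          by simp
        then show ?thesis by (simp add: y_def t_def)
      qed
      show "y (Suc j) k 0 = y j k \<tau>" for j k
        by (simp add: y_def sh_Suc add.commute)
      show "norm (y 0 k \<theta>) \<le> init_norm n \<tau> Y" if "k < n" "\<theta> \<in> {0..\<tau>}" for k \<theta>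
        unfolding y_def norm_of_real using that by (intro init_norm_ge[OF sol]) (auto simp: sh_def)
    qed (use n \<tau> r C twisted in auto)
    \<comment> \<open>The time t lies in window i + 1. As t < (i + 1) \<tau>, passing from r^i to
      exp (\<gamma> t) costs one extra factor \<open>r\<close>.\<close>
    define i where "i = nat \<lfloor>t / \<tau>\<rfloor>"
    have i: "real i \<le> t / \<tau>" "t / \<tau> < real i + 1"
      using t \<tau> unfolding i_def by (auto simp: of_nat_nat)
    then have i': "real i * \<tau> \<le> t" "t < (real i + 1) * \<tau>"
      using \<tau> by (auto simp: field_simps)
    define \<theta> where "\<theta> = t - real i * \<tau>"
    have \<theta>: "\<theta> \<in> {0..\<tau>}" using i' by (auto simp: \<theta>_def algebra_simps)
    have "w.D = K" unfolding w.D_def w.A_def K_def ..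
    have "norm (y (Suc i) 0 \<theta>) = \<bar>Y 0 t\<bar>"
      by (simp add: y_def sh_def \<theta>_def)
    then have "\<bar>Y 0 t\<bar> * r ^ i \<le> 2 * K * init_norm n \<tau> Y"
      using w.window_decay[OF n \<theta>, of i] \<open>w.D = K\<close> by simp
    moreover have "exp (\<gamma> * t) \<le> r ^ i * r"
    proof -
      have "\<gamma> * t \<le> \<gamma> * ((real i + 1) * \<tau>)"
        using i' \<gamma> by (intro mult_left_mono) auto
      moreover have "r ^ i * r = exp (\<gamma> * ((real i + 1) * \<tau>))"
        unfolding r_def exp_of_nat_mult[symmetric] exp_add[symmetric] by (simp add: algebra_simps)
      ultimately show ?thesis by simp
    qed
    ultimately have "\<bar>Y 0 t\<bar> * exp (\<gamma> * t) \<le> 2 * K * init_norm n \<tau> Y * r"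
      by (smt (verit) abs_ge_zero mult.assoc mult_left_mono mult_right_mono r)
    then have "\<bar>Y 0 t\<bar> \<le> 2 * K * init_norm n \<tau> Y * r * exp (- (\<gamma> * t))"
      by (simp add: exp_minus field_simps)
    then show ?thesis by (simp add: mult_ac)
  qed
  show ?thesis
    unfolding exp_stable_def
  proof (intro exI conjI allI impI)
    show "2 * K * r > 0" "\<gamma> > 0" using \<open>K > 0\<close> r \<gamma> by auto
  qed (use decay in auto)
qed

text \<open>The real root gives the solution exp (s0 t), which stays at least 1 for t >= 0.\<close>

lemma not_exp_stable_if_nonneg_root:
  assumes root: "Delta n \<tau> a \<alpha> (complex_of_real s0) = 0" and "s0 \<ge> 0"
  shows "\<not> exp_stable n \<tau> a \<alpha>"
proof
  assume "exp_stable n \<tau> a \<alpha>"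
  then obtain C \<gamma> where \<gamma>: "\<gamma> > 0"
    and bound: "\<And>Y t. dde_solution n \<tau> a \<alpha> Y \<Longrightarrow> t \<ge> 0 \<Longrightarrow> \<bar>Y 0 t\<bar> \<le> C * exp (- \<gamma> * t) * init_norm n \<tau> Y"
    unfolding exp_stable_def by blast
  define Y where "Y k t = s0 ^ k * exp (s0 * t)" for k t
  have sol: "dde_solution n \<tau> a \<alpha> Y"
    unfolding dde_solution_def
  proof (intro conjI allI impI)
    show "(Y k has_real_derivative Y (Suc k) t) (at t within {- \<tau>..})" for k t
      unfolding Y_def[abs_def] by (auto intro!: derivative_eq_intros)
    fix t :: real
    have "Delta n \<tau> a \<alpha> (complex_of_real s0) = complex_of_real
       (s0 ^ n + (\<Sum>k<n. a k * s0 ^ k) + exp (- s0 * \<tau>) * (\<Sum>k<n. \<alpha> k * s0 ^ k))"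
      by (simp add: Delta_def exp_of_real[symmetric])
    then have "s0 ^ n + (\<Sum>k<n. a k * s0 ^ k) + exp (- s0 * \<tau>) * (\<Sum>k<n. \<alpha> k * s0 ^ k) = 0"
      using root by (metis of_real_eq_0_iff)
    then have "exp (s0 * t) * (s0 ^ n + (\<Sum>k<n. a k * s0 ^ k) + exp (- s0 * \<tau>) * (\<Sum>k<n. \<alpha> k * s0 ^ k)) = 0"
      by simp
    moreover have "exp (s0 * (t - \<tau>)) = exp (s0 * t) * exp (- s0 * \<tau>)"
      by (simp add: algebra_simps flip: exp_add)
    ultimately show "Y n t + (\<Sum>k<n. a k * Y k t) + (\<Sum>k<n. \<alpha> k * Y k (t - \<tau>)) = 0"
      by (simp add: Y_def distrib_left sum_distrib_left mult_ac)
  qed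
  have "1 \<le> C * exp (- \<gamma> * t) * init_norm n \<tau> Y" if "0 \<le> t" for t
    using bound[OF sol that] assms(2) that by (simp add: Y_def) (meson mult_nonneg_nonneg one_le_exp_iff order.trans)
  then have "eventually (\<lambda>t. 1 \<le> C * exp (- \<gamma> * t) * init_norm n \<tau> Y) at_top"
    by (rule eventually_mono[OF eventually_ge_at_top[of 0]])
  moreover have "((\<lambda>t. C * exp (- \<gamma> * t) * init_norm n \<tau> Y) \<longlongrightarrow> C * 0 * init_norm n \<tau> Y) at_top"
  proof (intro tendsto_intros)
    have "filterlim (\<lambda>t. - \<gamma> * t) at_bot at_top"
      using \<gamma> by (intro filterlim_tendsto_neg_mult_at_bot[OF tendsto_const] filterlim_ident) auto
    then show "((\<lambda>t. exp (- \<gamma> * t)) \<longlongrightarrow> 0) at_top"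
      by (rule filterlim_compose[OF exp_at_bot])
  qed
  ultimately have "1 \<le> C * 0 * init_norm n \<tau> Y"
    by (intro tendsto_lowerbound[where F = at_top]) auto
  then show False by simp
qed

text \<open>For k = n - 1 only j = n - 1 remains in the sum. This converts the condition on the
  coefficient into one on the sign of s0.\<close>

lemma coeff_a_last:
  assumes "n > 0" "\<tau> > 0"
  shows "coeff_a n \<tau> s0 (n - 1) = - real n * s0 - (real n)\<^sup>2 / \<tau>"
proof -
  obtain m where m: "n = Suc m" using assms gr0_implies_Suc by blast
  have "n choose (n - 1) = n" "n - (n - 1) = 1" "2 * n - (n - 1) - 1 = n" "fact n / fact (n - 1) = real n"
    unfolding m by auto
  then show ?thesis
    unfolding coeff_a_def by (simp add: field_simps power2_eq_square)
qed

theorem theorem3p1: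
  fixes n :: nat and \<tau> s0 :: real and a \<alpha> :: "nat \<Rightarrow> real"
  assumes "n > 0" and "\<tau> > 0"
  shows "(root_mult_2n n \<tau> a \<alpha> (complex_of_real s0) \<longleftrightarrow> coeff_conditions n \<tau> a \<alpha> s0)
       \<and> (coeff_conditions n \<tau> a \<alpha> s0 \<longrightarrow>
            (\<forall>s. Delta n \<tau> a \<alpha> s = 0 \<and> s \<noteq> complex_of_real s0 \<longrightarrow> Re s < s0))
       \<and> (coeff_conditions n \<tau> a \<alpha> s0 \<longrightarrow>
            (exp_stable n \<tau> a \<alpha> \<longleftrightarrow> a (n - 1) > - (real n ^ 2) / \<tau>))"
proof (intro conjI impI allI)
  show "root_mult_2n n \<tau> a \<alpha> (complex_of_real s0) \<longleftrightarrow> coeff_conditions n \<tau> a \<alpha> s0"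
    by (rule root_mult_2n_iff_coeff_conditions[OF assms])
  assume cc: "coeff_conditions n \<tau> a \<alpha> s0"
  show strict: "Re s < s0" if "Delta n \<tau> a \<alpha> s = 0 \<and> s \<noteq> complex_of_real s0" for s
    using Delta_root_Re_less[OF assms cc] that by blast
  have root: "Delta n \<tau> a \<alpha> (complex_of_real s0) = 0"
    using assms by (simp add: Delta_eq_beta_transform[OF assms cc])
  have "Re s \<le> s0" if "Delta n \<tau> a \<alpha> s = 0" for s
    using strict[of s] that by (cases "s = complex_of_real s0") auto
  \<comment> \<open>By dominance s0 is itself the spectral abscissa, so its sign decides
    stability.\<close>
  then have "exp_stable n \<tau> a \<alpha> \<longleftrightarrow> s0 < 0"
    using exp_stable_if_roots_left[OF assms] not_exp_stable_if_nonneg_root[OF root] by (meson not_less)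
  also have "s0 < 0 \<longleftrightarrow> real n * s0 < 0"
    using assms by (simp add: mult_less_0_iff)
  also have "\<dots> \<longleftrightarrow> a (n - 1) > - (real n ^ 2) / \<tau>"
    using cc assms coeff_a_last[OF assms, of s0] by (simp add: coeff_conditions_def)
  finally show "exp_stable n \<tau> a \<alpha> \<longleftrightarrow> a (n - 1) > - (real n ^ 2) / \<tau>" .
qed

end
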